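(* Let $b\geq 2$ be an integer and let $A=(a_n)_{n=1}^{\infty}$ be a strictly increasing sequence of positive integers. Suppose that $\eta:=\lim_{n\to\infty}\frac{a_{n+1}}{a_n}$ exists and $1<\eta<+\infty$. Let $$l_0=\max\left\{1,\left\lfloor\frac{\log 2-\log(\eta-1)}{\log\eta}\right\rfloor+1\right\}.$$ Then for any $$\hat v\in\bigcup_{l=l_0}^{\infty}\left(\eta-\frac{2\eta}{\eta^{l}+1},\ \eta-\frac{2}{\eta^{l}}\right),$$ we have $$\dim_{\rm H}(\hat{\mathcal V}_{b,A}(\hat v))\le\max\left\{\frac{\eta^{l_1+1}-1-\eta^{l_1}\hat v}{(\eta^{l_1+1}-1)(1+\eta^{l_1}\hat v)},\ \frac{\eta^{l_1}-1-\eta^{l_1-1}\hat v}{\eta^{l_1-1}(\eta(\eta^{l_1}-1)-\hat v)}\right\}<\left(\frac{\eta-\hat v}{\eta+\hat v}\right)^2,$$ where $$l_1=l_1(\hat v):=\left\lfloor\frac{\log 2-\log(\eta-\hat v)}{\log\eta}\right\rfloor+1.$$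
   Context: $\|x\|$ denotes the distance from $x\in\mathbb R$ to the nearest integer; $\dim_{\rm H}$ is Hausdorff dimension; $\lfloor\cdot\rfloor$ is the floor function. For real $\xi$, $$\hat v_{b,A}(\xi):=\sup\Big\{\hat v\ge 0:\ \text{for all sufficiently large integers }N,\ \min_{1\le n\le N}\|b^{a_n}\xi\|<(b^{a_N})^{-\hat v}\Big\}\in[0,+\infty].$$ (The exponent is introduced for irrational $\xi$; for rational $\xi$ the same formula is used.) For $\hat v\in[0,\eta]$, $\hat{\mathcal V}_{b,A}(\hat v):=\{\xi\in\mathbb R:\hat v_{b,A}(\xi)\ge\hat v\}$. *)

theory Defs
  imports "HOL-Analysis.Analysis"
begin

(* Contribution diam(U)^s of one covering set, with the convention that the empty set
   contributes 0 and that diam(U)^0 = 1 for nonempty U (in HOL, 0 powr 0 = 0).  The library's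
   diameter is meaningful for bounded sets only, hence the boundedness condition below. *)
definition diam_pow :: "real \<Rightarrow> 'a::metric_space set \<Rightarrow> ennreal" where
  "diam_pow s U = (if U = {} then 0 else if s = 0 then 1 else ennreal (diameter U powr s))"

definition delta_covers :: "real \<Rightarrow> 'a::metric_space set \<Rightarrow> (nat \<Rightarrow> 'a set) set" where
  "delta_covers \<delta> E = {U. E \<subseteq> (\<Union>i. U i) \<and> (\<forall>i. bounded (U i) \<and> diameter (U i) \<le> \<delta>)}"

definition hausdorff_premeasure :: "real \<Rightarrow> real \<Rightarrow> 'a::metric_space set \<Rightarrow> ennreal" where
  "hausdorff_premeasure s \<delta> E = (INF U\<in>delta_covers \<delta> E. \<Sum>i. diam_pow s (U i))"

definition hausdorff_measure :: "real \<Rightarrow> 'a::metric_space set \<Rightarrow> ennreal" where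
  "hausdorff_measure s E = (SUP \<delta>\<in>{0<..}. hausdorff_premeasure s \<delta> E)"

definition hausdorff_dim :: "'a::metric_space set \<Rightarrow> ereal" where
  "hausdorff_dim E = (INF s\<in>{s. 0 \<le> s \<and> hausdorff_measure s E = 0}. ereal s)"

definition dist_nearest_int :: "real \<Rightarrow> real" where
  "dist_nearest_int x = infdist x \<int>"

(* Sequences are indexed from 1; the value a 0 is never used. *)
definition uniform_exponent :: "nat \<Rightarrow> (nat \<Rightarrow> nat) \<Rightarrow> real \<Rightarrow> ereal" where
  "uniform_exponent b a \<xi> =
     (SUP v\<in>{v. 0 \<le> v \<and>
         (\<forall>\<^sub>F N in sequentially.
            Min ((\<lambda>n. dist_nearest_int (real b ^ a n * \<xi>)) ` {1..N}) < (real b ^ a N) powr (- v))}.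
       ereal v)"

definition uniform_set :: "nat \<Rightarrow> (nat \<Rightarrow> nat) \<Rightarrow> real \<Rightarrow> real set" where
  "uniform_set b a v = {\<xi>. ereal v \<le> uniform_exponent b a \<xi>}"

definition l0 :: "real \<Rightarrow> int" where
  "l0 \<eta> = max 1 (\<lfloor>(ln 2 - ln (\<eta> - 1)) / ln \<eta>\<rfloor> + 1)"

definition l1 :: "real \<Rightarrow> real \<Rightarrow> int" where
  "l1 \<eta> v = \<lfloor>(ln 2 - ln (\<eta> - v)) / ln \<eta>\<rfloor> + 1"

definition dim_bound :: "real \<Rightarrow> real \<Rightarrow> real" where
  "dim_bound \<eta> v = (let l = l1 \<eta> v in
     max ((\<eta> powi (l + 1) - 1 - \<eta> powi l * v) / ((\<eta> powi (l + 1) - 1) * (1 + \<eta> powi l * v)))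
         ((\<eta> powi l - 1 - \<eta> powi (l - 1) * v) / (\<eta> powi (l - 1) * (\<eta> * (\<eta> powi l - 1) - v))))"

end

theory Submission
  imports Defs
begin

text \<open>
  Let \<open>n\<^sub>1 < n\<^sub>2 < \<dots>\<close> be the indices at which \<open>\<parallel>b\<^bsup>a\<^sub>n\<^esup> \<xi>\<parallel>\<close> attains a new minimum and put
  \<open>x\<^sub>k = a (n\<^sub>k)\<close>. For every \<open>w < v / \<eta>\<close> there are integers \<open>q\<^sub>k\<close> such that \<open>\<xi>\<close> lies within
  \<open>b powr - (x\<^sub>k + w x\<^sub>k\<^sub>+\<^sub>1)\<close> of the fraction with numerator \<open>q\<^sub>k\<close> and denominator \<open>b powr x\<^sub>k\<close>. Consecutive
  fractions differ, so \<open>q\<^sub>k\<close> leaves at most \<open>6 b powr ((1 - w) x\<^sub>k\<^sub>+\<^sub>1 - x\<^sub>k)\<close> choices for \<open>q\<^sub>k\<^sub>+\<^sub>1\<close>; hence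
  \<open>6\<^sup>k b powr (x\<^sub>k - w S\<^sub>k)\<close> balls suffice at stage \<open>k\<close>, where \<open>S\<^sub>k = x\<^sub>1 + \<dots> + x\<^sub>k\<close>. As \<open>a\<close> grows
  geometrically, the \<open>2\<^sup>n\<close> choices of earlier indices and the factor \<open>6\<^sup>k\<close> are negligible, and the balls of
  those stages with \<open>x\<^sub>k - w S\<^sub>k < T (x\<^sub>k + w x\<^sub>k\<^sub>+\<^sub>1)\<close> have a finite sum of \<open>s\<close>-th powers for \<open>s > T\<close>.

  Such stages recur as soon as \<open>T\<close> exceeds \<open>ratio_bound w q\<close> for all eventual ratios \<open>q = x\<^sub>k\<^sub>+\<^sub>1 / x\<^sub>k\<close>:
  otherwise \<open>S\<^sub>k / x\<^sub>k\<close>, which is at most \<open>1 / w\<close>, would grow by a fixed amount at every stage. The ratios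
  are asymptotically powers of \<open>\<eta>\<close>, and \<open>ratio_bound w\<close> increases up to \<open>2 / (1 - w)\<close>, where its value is
  \<open>((1 - w) / (1 + w))\<^sup>2\<close>, and decreases afterwards. Therefore only the two powers of \<open>\<eta>\<close> next to that point matter.
\<close>

section \<open>Hausdorff content\<close>

text \<open>With no bound on the diameters there is no \<open>\<delta>\<close> to carry along. Only
  the vanishing of the content matters later, and for \<open>0 < s\<close> it passes to
  \<open>hausdorff_measure\<close>.\<close>

definition hausdorff_content :: "real \<Rightarrow> 'a::metric_space set \<Rightarrow> ennreal" where
  "hausdorff_content s E =
     (INF U\<in>{U. E \<subseteq> (\<Union>i. U i) \<and> (\<forall>i. bounded (U i))}. \<Sum>i::nat. diam_pow s (U i))"

lemma hausdorff_content_le_suminf: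
  assumes "E \<subseteq> (\<Union>i. U i)" "\<And>i. bounded (U i)"
  shows "hausdorff_content s E \<le> (\<Sum>i::nat. diam_pow s (U i))"
  unfolding hausdorff_content_def using assms by (intro INF_lower) auto

lemma hausdorff_content_mono: "E \<subseteq> F \<Longrightarrow> hausdorff_content s E \<le> hausdorff_content s F"
  unfolding hausdorff_content_def by (intro INF_superset_mono) auto

lemma hausdorff_content_le_diam_pow:
  assumes "bounded E"
  shows "hausdorff_content s E \<le> diam_pow s E"
proof -
  have "hausdorff_content s E \<le> (\<Sum>i::nat. diam_pow s (if i = 0 then E else {}))"
    using assms by (intro hausdorff_content_le_suminf) auto
  also have "\<dots> = (\<Sum>i\<in>{0::nat}. diam_pow s (if i = 0 then E else {}))"
    by (intro suminf_finite) (auto simp: diam_pow_def)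
  finally show ?thesis by simp
qed

lemma hausdorff_content_empty [simp]: "hausdorff_content s {} = 0"
  using hausdorff_content_le_diam_pow[of "{}" s] by (simp add: diam_pow_def)

lemma hausdorff_content_UN:
  fixes E :: "nat \<Rightarrow> 'a::metric_space set"
  shows "hausdorff_content s (\<Union>n. E n) \<le> (\<Sum>n. hausdorff_content s (E n))"
proof (rule ennreal_le_epsilon)
  fix e :: real
  assume fin: "(\<Sum>n. hausdorff_content s (E n)) < top" and e: "0 < e"
  have "\<exists>U. E n \<subseteq> (\<Union>i. U i) \<and> (\<forall>i. bounded (U i)) \<and>
      (\<Sum>i::nat. diam_pow s (U i)) < hausdorff_content s (E n) + ennreal (e * (1/2)^Suc n)" for n
  proof -
    have "hausdorff_content s (E n) \<le> (\<Sum>n. hausdorff_content s (E n))"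
      using sum_le_suminf[of "\<lambda>n. hausdorff_content s (E n)" "{n}"] by simp
    then have "hausdorff_content s (E n) \<noteq> \<infinity>" using fin by auto
    from INF_approx_ennreal[OF _ hausdorff_content_def this, of "e * (1/2)^Suc n"]
    show ?thesis using e by (force simp: ennreal_zero_less_mult_iff)
  qed
  then obtain V where V: "\<And>n. E n \<subseteq> (\<Union>i. V n i)" "\<And>n i. bounded (V n i)"
    "\<And>n. (\<Sum>i::nat. diam_pow s (V n i)) < hausdorff_content s (E n) + ennreal (e * (1/2)^Suc n)"
    by metis
  define W where "W k = (case prod_decode k of (n, i) \<Rightarrow> V n i)" for k
  have "hausdorff_content s (\<Union>n. E n) \<le> (\<Sum>k. diam_pow s (W k))"
  proof (rule hausdorff_content_le_suminf)
    show "(\<Union>n. E n) \<subseteq> (\<Union>k. W k)"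
    proof
      fix x assume "x \<in> (\<Union>n. E n)"
      then obtain n i where "x \<in> V n i" using V(1) by blast
      then have "x \<in> W (prod_encode (n, i))" by (simp add: W_def)
      then show "x \<in> (\<Union>k. W k)" by blast
    qed
    show "bounded (W k)" for k by (simp add: W_def V(2) split: prod.split)
  qed
  also have "\<dots> = (\<Sum>k. (\<lambda>(n, i). diam_pow s (V n i)) (prod_decode k))"
    by (simp add: W_def case_prod_beta)
  also have "\<dots> = (\<Sum>n. \<Sum>i. diam_pow s (V n i))"
    by (rule suminf_ennreal_2dimen) simp
  also have "\<dots> \<le> (\<Sum>n. hausdorff_content s (E n) + ennreal (e * (1/2)^Suc n))"
    using V(3) by (intro suminf_le) (auto intro: less_imp_le)
  also have "\<dots> = (\<Sum>n. hausdorff_content s (E n)) + (\<Sum>n. ennreal (e * (1/2)^Suc n))"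
    by (intro suminf_add[symmetric]) auto
  also have "(\<Sum>n. ennreal (e * (1/2)^Suc n)) = ennreal e"
    using e by (intro suminf_ennreal_eq) (use sums_mult[OF power_half_series, of e] in auto)
  finally show "hausdorff_content s (\<Union>n. E n) \<le> (\<Sum>n. hausdorff_content s (E n)) + ennreal e" .
qed

lemma hausdorff_content_Un:
  "hausdorff_content s (A \<union> B) \<le> hausdorff_content s A + hausdorff_content s B"
proof -
  define E where "E n = (if n = 0 then A else if n = Suc 0 then B else {})" for n :: nat
  have "hausdorff_content s (A \<union> B) \<le> hausdorff_content s (\<Union>n. E n)"
    by (intro hausdorff_content_mono) (force simp: E_def)
  also have "\<dots> \<le> (\<Sum>n. hausdorff_content s (E n))" by (rule hausdorff_content_UN)
  also have "\<dots> = (\<Sum>n\<in>{0, Suc 0}. hausdorff_content s (E n))"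
    by (intro suminf_finite) (auto simp: E_def)
  finally show ?thesis by (simp add: E_def)
qed

lemma hausdorff_content_finite_UN:
  "finite I \<Longrightarrow> hausdorff_content s (\<Union>i\<in>I. E i) \<le> (\<Sum>i\<in>I. hausdorff_content s (E i))"
proof (induction I rule: finite_induct)
  case (insert i I)
  have "hausdorff_content s (\<Union>i\<in>insert i I. E i)
      \<le> hausdorff_content s (E i) + hausdorff_content s (\<Union>i\<in>I. E i)"
    using hausdorff_content_Un by simp
  then show ?case using insert by (auto intro: order_trans add_left_mono)
qed simp

lemma hausdorff_content_eq_0_UN:
  fixes E :: "'i \<Rightarrow> 'a::metric_space set"
  assumes "countable I" "\<And>i. i \<in> I \<Longrightarrow> hausdorff_content s (E i) = 0"
  shows "hausdorff_content s (\<Union>i\<in>I. E i) = 0"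
proof (cases "I = {}")
  case False
  then have "(\<Union>i\<in>I. E i) = (\<Union>n. E (from_nat_into I n))"
    using range_from_nat_into[OF False assms(1)] by (metis image_image)
  then show ?thesis
    using hausdorff_content_UN[of s "\<lambda>n. E (from_nat_into I n)"] assms(2) from_nat_into[OF False]
    by simp
qed simp

lemma hausdorff_content_countable:
  assumes "0 < s" "countable E"
  shows "hausdorff_content s E = 0"
proof -
  have "hausdorff_content s {x} = 0" for x :: 'a
    using hausdorff_content_le_diam_pow[of "{x}" s] assms(1) by (simp add: diam_pow_def)
  then have "hausdorff_content s (\<Union>x\<in>E. {x}) = 0"
    by (intro hausdorff_content_eq_0_UN assms(2))
  then show ?thesis by simp
qed

text \<open>A cover whose sum is below \<open>\<delta> powr s\<close> consists of sets of diameter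
  at most \<open>\<delta>\<close>, so a cheap cover is automatically a
  \<open>\<delta>\<close>-cover. Hence the minimum in \<open>e'\<close>.\<close>

lemma hausdorff_measure_eq_0_if_content:
  fixes E :: "'a::metric_space set"
  assumes s: "0 < s" and "hausdorff_content s E = 0"
  shows "hausdorff_measure s E = 0"
proof -
  have "hausdorff_premeasure s \<delta> E \<le> 0" if \<delta>: "0 < \<delta>" for \<delta>
  proof (rule ennreal_le_epsilon)
    fix e :: real assume e: "0 < e"
    define e' where "e' = min e (\<delta> powr s)"
    have e': "0 < e'" using e \<delta> by (simp add: e'_def)
    obtain U where U: "E \<subseteq> (\<Union>i. U i)" "\<And>i. bounded (U i)"
      and lt: "(\<Sum>i::nat. diam_pow s (U i)) < ennreal e'"
    proof -
      from INF_approx_ennreal[OF _ hausdorff_content_def, of "e'" s E] e' assms(2)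
      show ?thesis using that by (auto simp: infinity_ennreal_def)
    qed
    have "diameter (U i) \<le> \<delta>" for i
    proof (cases "U i = {}")
      case False
      have "diam_pow s (U i) \<le> (\<Sum>i::nat. diam_pow s (U i))"
        using sum_le_suminf[of "\<lambda>i. diam_pow s (U i)" "{i}"] by simp
      with lt have "diam_pow s (U i) < ennreal e'" by simp
      then have "diameter (U i) powr s < e'"
        using False s by (simp add: diam_pow_def ennreal_less_iff)
      then have "diameter (U i) powr s < \<delta> powr s" by (simp add: e'_def)
      then show ?thesis
        using s \<delta> by (meson less_eq_real_def not_le powr_less_mono2 powr_mono2)
    qed (use \<delta> in simp)
    then have "U \<in> delta_covers \<delta> E" using U by (auto simp: delta_covers_def)
    then have "hausdorff_premeasure s \<delta> E \<le> (\<Sum>i. diam_pow s (U i))"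
      unfolding hausdorff_premeasure_def by (rule INF_lower)
    also have "\<dots> \<le> ennreal e" using lt ennreal_leI[of e' e] by (auto simp: e'_def)
    finally show "hausdorff_premeasure s \<delta> E \<le> 0 + ennreal e" by simp
  qed
  then show ?thesis unfolding hausdorff_measure_def by (auto simp: SUP_eq_iff intro!: antisym SUP_least)
qed

text \<open>Borel-Cantelli: every tail of the \<open>A n\<close> covers \<open>E\<close>, and the
  tails of a convergent series tend to 0.\<close>

lemma hausdorff_content_limsup_eq_0:
  fixes A :: "nat \<Rightarrow> 'a::metric_space set"
  assumes "\<And>n. hausdorff_content s (A n) \<le> ennreal (t n)"
    and "\<And>n. 0 \<le> t n" "summable t"
    and "\<And>x. x \<in> E \<Longrightarrow> \<exists>\<^sub>\<infinity>n. x \<in> A n"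
  shows "hausdorff_content s E = 0"
proof -
  have "hausdorff_content s E \<le> ennreal (\<Sum>n. t (n + N))" for N
  proof -
    have "E \<subseteq> (\<Union>n. A (n + N))"
    proof
      fix x assume "x \<in> E"
      then obtain n where "n \<ge> N" "x \<in> A n"
        using assms(4) by (auto simp: INFM_nat_le)
      then have "x \<in> A ((n - N) + N)" by simp
      then show "x \<in> (\<Union>n. A (n + N))" by blast
    qed
    then have "hausdorff_content s E \<le> (\<Sum>n. hausdorff_content s (A (n + N)))"
      using hausdorff_content_mono hausdorff_content_UN order_trans by metis
    also have "\<dots> \<le> (\<Sum>n. ennreal (t (n + N)))"
      using assms(1) by (intro suminf_le) auto
    also have "\<dots> = ennreal (\<Sum>n. t (n + N))"
      using assms(2,3) by (intro suminf_ennreal2) (auto simp: summable_iff_shift)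
    finally show ?thesis .
  qed
  moreover have "(\<lambda>N. ennreal (\<Sum>n. t (n + N))) \<longlonglongrightarrow> ennreal 0"
    by (intro tendsto_ennrealI suminf_exist_split2 assms(3))
  ultimately have "hausdorff_content s E \<le> ennreal 0"
    by (intro tendsto_lowerbound[of "\<lambda>N. ennreal (\<Sum>n. t (n + N))"]) auto
  then show ?thesis by simp
qed

section \<open>The dimension bound as a function of the ratio of consecutive indices\<close>

text \<open>In a geometric progression of ratio \<open>q\<close> the quotient of partial sum by last
  term tends to \<open>\<sigma> = q / (q - 1)\<close>, and \<open>ratio_bound w q\<close> is
  \<open>(1 - w * \<sigma>) / (1 + w * q)\<close>: the exponent at which number and radius of the
  balls of a stage balance.\<close>

definition ratio_bound :: "real \<Rightarrow> real \<Rightarrow> real" where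
  "ratio_bound w q = ((1 - w) * q - 1) / ((q - 1) * (1 + w * q))"

text \<open>This is the cross-multiplied difference of \<open>ratio_bound w q\<close> and
  \<open>ratio_bound w p\<close>. For positive \<open>p\<close>, \<open>q\<close> the last factor
  has the sign of \<open>1 / p + 1 / q - (1 - w)\<close>, which makes \<open>2 / (1 - w)\<close> the
  turning point.\<close>

lemma ratio_bound_diff:
  fixes w p q :: real
  shows "((1 - w) * q - 1) * ((p - 1) * (1 + w * p)) - ((1 - w) * p - 1) * ((q - 1) * (1 + w * q))
    = w * (q - p) * (p + q - (1 - w) * p * q)"
  by algebra

lemma ratio_bound_mono:
  assumes w: "0 < w" "w < 1" and pq: "1 < p" "p \<le> q" "q \<le> 2 / (1 - w)"
  shows "ratio_bound w p \<le> ratio_bound w q"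
proof -
  have q2: "(1 - w) * q \<le> 2" using w pq by (simp add: field_simps)
  have "p * ((1 - w) * q) \<le> p * 2" using q2 pq by (intro mult_left_mono) auto
  then have "0 \<le> p + q - (1 - w) * p * q" using pq by (simp add: algebra_simps)
  then have "0 \<le> w * (q - p) * (p + q - (1 - w) * p * q)" using w pq by simp
  with ratio_bound_diff[of w q p]
  have "((1 - w) * p - 1) * ((q - 1) * (1 + w * q)) \<le> ((1 - w) * q - 1) * ((p - 1) * (1 + w * p))"
    by linarith
  moreover have "0 < (q - 1) * (1 + w * q)" "0 < (p - 1) * (1 + w * p)"
    using w pq by (auto intro!: mult_pos_pos add_pos_pos)
  ultimately show ?thesis unfolding ratio_bound_def by (simp add: frac_le_eq divide_le_eq pos_le_divide_eq)
qed

lemma ratio_bound_antimono: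
  assumes w: "0 < w" "w < 1" and pq: "2 / (1 - w) \<le> p" "p \<le> q"
  shows "ratio_bound w q \<le> ratio_bound w p"
proof -
  have q2: "2 \<le> (1 - w) * p" using w pq by (simp add: field_simps)
  have "2 / (1 - w) > 1" using w by simp
  then have p1: "1 < p" using pq by linarith
  have "q * 2 \<le> q * ((1 - w) * p)" using q2 pq p1 by (intro mult_left_mono) auto
  then have "p + q - (1 - w) * p * q \<le> 0" using pq by (simp add: algebra_simps)
  then have "w * (q - p) * (p + q - (1 - w) * p * q) \<le> 0" using w pq by (simp add: mult_nonneg_nonpos)
  with ratio_bound_diff[of w q p]
  have "((1 - w) * q - 1) * ((p - 1) * (1 + w * p)) \<le> ((1 - w) * p - 1) * ((q - 1) * (1 + w * q))"
    by linarith
  moreover have "0 < (q - 1) * (1 + w * q)" "0 < (p - 1) * (1 + w * p)"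
    using w pq p1 by (auto intro!: mult_pos_pos add_pos_pos)
  ultimately show ?thesis unfolding ratio_bound_def by (simp add: frac_le_eq divide_le_eq pos_le_divide_eq)
qed

text \<open>Cleared of denominators, the gap is \<open>w\<close> times a perfect square that
  vanishes only at \<open>q = 2 / (1 - w)\<close>.\<close>

lemma ratio_bound_less:
  assumes w: "0 < w" "w < 1" and q: "1 < q" "q \<noteq> 2 / (1 - w)"
  shows "ratio_bound w q < ((1 - w) / (1 + w))\<^sup>2"
proof -
  have "(1 - w) * q - 2 \<noteq> 0" using q w by (simp add: field_simps)
  then have "0 < w * ((1 - w) * q - 2)\<^sup>2" using w by simp
  also have "\<dots> = (1 - w)\<^sup>2 * ((q - 1) * (1 + w * q)) - ((1 - w) * q - 1) * (1 + w)\<^sup>2"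
    by algebra
  finally have "((1 - w) * q - 1) * (1 + w)\<^sup>2 < (1 - w)\<^sup>2 * ((q - 1) * (1 + w * q))" by simp
  moreover have "0 < (q - 1) * (1 + w * q)"
    using w q by (auto intro!: mult_pos_pos add_pos_pos)
  ultimately show ?thesis
    using w unfolding ratio_bound_def by (simp add: power_divide divide_less_eq pos_less_divide_eq)
qed

text \<open>The second term of \<open>dim_bound\<close>, rewritten with \<open>L = \<eta> ^ l\<close> and \<open>w = v / \<eta>\<close>.\<close>

lemma second_term_less:
  fixes w L :: real
  assumes w: "0 < w" "w < 1" and L: "0 < L" "1 + w < L" and ne: "(1 - w) * (L + 1) \<noteq> 2"
  shows "(L - 1 - L * w) / (L * (L - 1 - w)) < ((1 - w) / (1 + w))\<^sup>2"
proof -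
  have "0 < ((L + 1) * (1 - w) - 2)\<^sup>2" using ne by (simp add: algebra_simps)
  also have "\<dots> = (1 - w)\<^sup>2 * (L * (L - 1 - w)) - (L - 1 - L * w) * (1 + w)\<^sup>2"
    by algebra
  finally have "(L - 1 - L * w) * (1 + w)\<^sup>2 < (1 - w)\<^sup>2 * (L * (L - 1 - w))" by simp
  moreover have "0 < L * (L - 1 - w)" using L by simp
  ultimately show ?thesis using w by (simp add: power_divide divide_less_eq pos_less_divide_eq)
qed

text \<open>Both fractions have the numerator \<open>(1 - w) * L - 1\<close>, and \<open>u\<close>
  makes the denominator on the right the smaller one. So the second term of \<open>dim_bound\<close>
  dominates \<open>ratio_bound\<close> at \<open>L = \<eta> ^ l\<close>.\<close>

lemma ratio_bound_le_second_term:
  fixes w L :: real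
  assumes w: "0 < w" "w < 1" and L: "1 < L" "1 + w < L" and u: "(1 - w) * (L + 1) \<le> 2"
    and pos: "0 \<le> (1 - w) * L - 1"
  shows "ratio_bound w L \<le> (L - 1 - L * w) / (L * (L - 1 - w))"
proof -
  have "(L - 1) * ((1 - w) * (L + 1)) \<le> (L - 1) * 2" using u L by (intro mult_left_mono) auto
  then have "L * (L - 1 - w) \<le> (L - 1) * (1 + w * L)" using w by (simp add: algebra_simps)
  moreover have "0 < L * (L - 1 - w)" using L by simp
  ultimately have "((1 - w) * L - 1) / ((L - 1) * (1 + w * L)) \<le> ((1 - w) * L - 1) / (L * (L - 1 - w))"
    using pos by (intro divide_left_mono) auto
  then show ?thesis by (simp add: ratio_bound_def algebra_simps)
qed

text \<open>With \<open>w = v / \<eta>\<close> the interval for \<open>v\<close> says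
  \<open>\<eta> ^ l + 1 < 2 / (1 - w) < \<eta> ^ Suc l\<close>: the maximum point of
  \<open>ratio_bound w\<close> lies strictly between consecutive powers of \<open>\<eta>\<close>.
  Taking logarithms identifies \<open>l\<close> as \<open>l1 \<eta> v\<close>.\<close>

lemma exponent_window:
  fixes \<eta> v :: real
  assumes \<eta>: "1 < \<eta>"
    and v: "v \<in> (\<Union>l\<in>{l0 \<eta>..}. {\<eta> - 2 * \<eta> / (\<eta> powi l + 1) <..< \<eta> - 2 / \<eta> powi l})"
  obtains l :: nat where "1 \<le> l" "l1 \<eta> v = int l" "0 < v" "v < \<eta>" "1 + v / \<eta> < \<eta> ^ l"
    "(1 - v / \<eta>) * (\<eta> ^ l + 1) < 2" "2 < (1 - v / \<eta>) * \<eta> ^ Suc l"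
proof -
  from v obtain i where i: "l0 \<eta> \<le> i" and lo: "\<eta> - 2 * \<eta> / (\<eta> powi i + 1) < v"
    and hi: "v < \<eta> - 2 / \<eta> powi i" by auto
  define l where "l = nat i"
  have il: "i = int l" and l1': "1 \<le> l" using i by (auto simp: l0_def l_def)
  define L where "L = \<eta> ^ l"
  have L: "\<eta> powi i = L" by (simp add: il L_def)
  have L\<eta>: "\<eta> \<le> L" using \<eta> l1' power_increasing[of 1 l \<eta>] by (simp add: L_def)
  have lo': "(\<eta> - v) * (L + 1) < 2 * \<eta>" and hi': "2 < (\<eta> - v) * L"
    using lo hi L\<eta> \<eta> unfolding L by (simp_all add: field_simps)
  have vl: "v < \<eta>" using hi L\<eta> \<eta> unfolding L by (smt (verit) divide_pos_pos)
  have "(\<eta> - v) * (\<eta> + 1) \<le> (\<eta> - v) * (L + 1)" using vl L\<eta> by simp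
  then have "v * (\<eta> + 1) > \<eta> * (\<eta> - 1)" using lo' by (simp add: algebra_simps)
  moreover have "\<eta> * (\<eta> - 1) > 0" using \<eta> by simp
  ultimately have v0: "0 < v" using \<eta> by (smt (verit) mult_nonpos_nonneg)
  \<comment> \<open>The bound \<open>l0 \<eta> \<le> i\<close> gives
    \<open>2 < L * (\<eta> - 1)\<close>. For \<open>\<eta> < 2\<close> this forces
    \<open>L > 2\<close>, which later keeps the factor \<open>L - 1 - w\<close> positive.\<close>
  have "(ln 2 - ln (\<eta> - 1)) / ln \<eta> < real_of_int i" using i unfolding l0_def by linarith
  then have "ln (2 / (\<eta> - 1)) < real l * ln \<eta>" using \<eta> by (simp add: il ln_div field_simps)
  then have "ln (2 / (\<eta> - 1)) < ln L" using \<eta> by (simp add: L_def ln_realpow)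
  then have L2: "2 < L * (\<eta> - 1)" using \<eta> L\<eta> by (simp add: field_simps)
  have v\<eta>: "v / \<eta> < 1" using vl \<eta> by simp
  have L3: "1 + v / \<eta> < L"
  proof (cases "\<eta> < 2")
    case True
    then have "L * (\<eta> - 1) < L * 1" using L\<eta> \<eta> by (intro mult_strict_left_mono) auto
    then show ?thesis using L2 v\<eta> by linarith
  qed (use L\<eta> v\<eta> in linarith)
  \<comment> \<open>The upper endpoint bounds the argument of the floor above by \<open>l\<close>;
    the lower endpoint, with its \<open>+ 1\<close> dropped, bounds it below by
    \<open>l - 1\<close>.\<close>
  have "l1 \<eta> v = i"
  proof -
    have "ln (2 / (\<eta> - v)) < ln L" using hi' vl L\<eta> \<eta> by (simp add: field_simps)
    then have 1: "(ln 2 - ln (\<eta> - v)) / ln \<eta> < real l" using \<eta> vl by (simp add: L_def ln_realpow ln_div field_simps)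
    have "L / \<eta> \<le> 2 / (\<eta> - v)" using lo' vl \<eta> by (simp add: field_simps)
    then have "ln (L / \<eta>) \<le> ln (2 / (\<eta> - v))" using L\<eta> \<eta> vl by simp
    then have "real l - 1 \<le> (ln 2 - ln (\<eta> - v)) / ln \<eta>"
      using \<eta> vl L\<eta> by (simp add: L_def ln_realpow ln_div field_simps)
    with 1 have "\<lfloor>(ln 2 - ln (\<eta> - v)) / ln \<eta>\<rfloor> = i - 1" by (simp add: floor_unique il)
    then show ?thesis by (simp add: l1_def)
  qed
  moreover have "(1 - v / \<eta>) * (L + 1) < 2" using lo' \<eta> by (simp add: field_simps)
  moreover have "2 < (1 - v / \<eta>) * (\<eta> * L)"
  proof -
    have eq: "(1 - v / \<eta>) * (\<eta> * L) = (\<eta> - v) * L" using \<eta> by (simp add: field_simps)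
    show ?thesis using hi' by (simp only: eq)
  qed
  ultimately show ?thesis using that[of l] l1' il v0 vl L3 by (simp add: L_def)
qed

text \<open>The first term of \<open>dim_bound\<close> is exactly \<open>ratio_bound\<close> at
  \<open>\<eta> ^ Suc l\<close>. Both terms stay strictly below the maximum value because, with
  \<open>w = v / \<eta>\<close>, the point \<open>2 / (1 - w)\<close> equals neither
  \<open>\<eta> ^ Suc l\<close> nor \<open>\<eta> ^ l + 1\<close>.\<close>

lemma dim_bound_properties:
  fixes \<eta> v :: real
  assumes \<eta>: "1 < \<eta>" and l: "1 \<le> l" "l1 \<eta> v = int l" and v: "0 < v" "v < \<eta>" "1 + v / \<eta> < \<eta> ^ l"
    and lo: "(1 - v / \<eta>) * (\<eta> ^ l + 1) < 2" and hi: "2 < (1 - v / \<eta>) * \<eta> ^ Suc l"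
  shows "0 < dim_bound \<eta> v" "ratio_bound (v / \<eta>) (\<eta> ^ l) \<le> dim_bound \<eta> v"
    "ratio_bound (v / \<eta>) (\<eta> ^ Suc l) \<le> dim_bound \<eta> v" "dim_bound \<eta> v < ((\<eta> - v) / (\<eta> + v))\<^sup>2"
proof -
  define w L where "w = v / \<eta>" and "L = \<eta> ^ l"
  have w: "0 < w" "w < 1" using v \<eta> by (auto simp: w_def)
  have vw: "v = w * \<eta>" using \<eta> by (simp add: w_def)
  have L\<eta>: "\<eta> \<le> L" using \<eta> l power_increasing[of 1 l \<eta>] by (simp add: L_def)
  have w': "1 + w < L" "(1 - w) * (L + 1) < 2" "2 < (1 - w) * (\<eta> * L)"
    using v lo hi by (auto simp: w_def L_def)
  have pw: "\<eta> powi (int l + 1) = \<eta> * L" "\<eta> powi int l = L" "\<eta> powi (int l - 1) = L / \<eta>"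
    using \<eta> l by (auto simp: L_def power_int_add power_int_diff)
  have d: "dim_bound \<eta> v = max (ratio_bound w (\<eta> * L)) ((L - 1 - L * w) / (L * (L - 1 - w)))"
  proof -
    have "(\<eta> * L - 1 - L * v) / ((\<eta> * L - 1) * (1 + L * v)) = ratio_bound w (\<eta> * L)"
      unfolding ratio_bound_def by (simp add: vw algebra_simps)
    moreover have "(L - 1 - L / \<eta> * v) / (L / \<eta> * (\<eta> * (L - 1) - v)) = (L - 1 - L * w) / (L * (L - 1 - w))"
    proof -
      have "L / \<eta> * v = L * w" "L / \<eta> * (\<eta> * (L - 1) - v) = L * (L - 1 - w)"
        using \<eta> by (simp_all add: vw field_simps)
      then show ?thesis by simp
    qed
    ultimately show ?thesis unfolding dim_bound_def Let_def l(2) pw by (simp only:)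
  qed
  have q1: "1 < \<eta> * L" using \<eta> L\<eta> by (smt (verit) mult_le_cancel_left1)
  have pos: "0 < ratio_bound w (\<eta> * L)"
    unfolding ratio_bound_def using w w' q1 \<eta> L\<eta> by (auto intro!: divide_pos_pos mult_pos_pos add_pos_pos)
  then show "0 < dim_bound \<eta> v" by (simp add: d)
  show "ratio_bound (v / \<eta>) (\<eta> ^ Suc l) \<le> dim_bound \<eta> v"
    by (simp add: d w_def[symmetric] L_def[symmetric])
  have "ratio_bound w L \<le> dim_bound \<eta> v"
  proof (cases "0 \<le> (1 - w) * L - 1")
    case True
    then show ?thesis using ratio_bound_le_second_term[of w L] w w' \<eta> L\<eta> by (auto simp: d)
  next
    \<comment> \<open>With a negative numerator \<open>ratio_bound w L\<close> is at most 0, and the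
      positive first term suffices.\<close>
    case False
    then have "ratio_bound w L \<le> 0" unfolding ratio_bound_def
      using w \<eta> L\<eta> by (intro divide_nonpos_nonneg mult_nonneg_nonneg) auto
    then show ?thesis using pos by (simp add: d)
  qed
  then show "ratio_bound (v / \<eta>) (\<eta> ^ l) \<le> dim_bound \<eta> v" by (simp add: w_def L_def)
  have "(1 - w) / (1 + w) = (\<eta> - v) / (\<eta> + v)"
    using \<eta> v by (simp add: w_def divide_simps)
  moreover have "ratio_bound w (\<eta> * L) < ((1 - w) / (1 + w))\<^sup>2"
    using w w' q1 \<eta> by (intro ratio_bound_less) (auto simp: field_simps)
  moreover have "(L - 1 - L * w) / (L * (L - 1 - w)) < ((1 - w) / (1 + w))\<^sup>2"
    using w w' by (intro second_term_less) auto
  ultimately show "dim_bound \<eta> v < ((\<eta> - v) / (\<eta> + v))\<^sup>2" by (simp add: d)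
qed

text \<open>For fixed \<open>j\<close> the ratio \<open>a (n + j) / a n\<close> tends to
  \<open>\<eta> ^ j\<close>, but the bound has to be uniform in \<open>m\<close>. Monotonicity on
  either side of \<open>2 / (1 - w)\<close> reduces \<open>m \<le> n + l\<close> to
  \<open>j = l\<close> and all larger \<open>m\<close> to \<open>j = Suc l\<close>, so two limits
  suffice.\<close>

lemma eventually_ratio_bound_le:
  fixes a :: "nat \<Rightarrow> nat" and \<eta> w T :: real
  assumes \<eta>: "1 < \<eta>" and lim: "(\<lambda>n. real (a (n + 1)) / real (a n)) \<longlonglongrightarrow> \<eta>"
    and mono: "\<And>i j. 1 \<le> i \<Longrightarrow> i < j \<Longrightarrow> a i < a j" and pos: "\<And>n. 1 \<le> n \<Longrightarrow> 0 < a n"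
    and w: "0 < w" "w < 1" and l: "1 \<le> l"
    and win: "\<eta> ^ l < 2 / (1 - w)" "2 / (1 - w) < \<eta> ^ Suc l"
    and T: "ratio_bound w (\<eta> ^ l) < T" "ratio_bound w (\<eta> ^ Suc l) < T"
  shows "\<forall>\<^sub>F n in sequentially. \<forall>m>n. ratio_bound w (real (a m) / real (a n)) \<le> T"
proof -
  define r where "r j n = real (a (n + j)) / real (a n)" for j n
  have r_lim: "r j \<longlonglongrightarrow> \<eta> ^ j" for j
  proof (induction j)
    case 0
    have "\<forall>\<^sub>F n in sequentially. r 0 n = 1"
      using eventually_ge_at_top[of 1] by eventually_elim (use pos in \<open>force simp: r_def\<close>)
    then show ?case by (simp add: tendsto_eventually)
  next
    case (Suc j)
    have "(\<lambda>n. real (a ((n + j) + 1)) / real (a (n + j)) * r j n) \<longlonglongrightarrow> \<eta> * \<eta> ^ j"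
      by (intro tendsto_mult Suc LIMSEQ_ignore_initial_segment[OF lim])
    moreover have "\<forall>\<^sub>F n in sequentially. real (a ((n + j) + 1)) / real (a (n + j)) * r j n = r (Suc j) n"
      using eventually_ge_at_top[of 1]
    proof eventually_elim
      case (elim n)
      then have "a (n + j) \<noteq> 0" using pos[of "n + j"] by simp
      then show ?case by (simp add: r_def)
    qed
    ultimately show ?case by (simp add: tendsto_cong)
  qed
  have rb_lim: "(\<lambda>n. ratio_bound w (r j n)) \<longlonglongrightarrow> ratio_bound w (\<eta> ^ j)" if "1 \<le> j" for j
  proof -
    have "1 < \<eta> ^ j" using \<eta> that by simp
    then have "(\<eta> ^ j - 1) * (1 + w * \<eta> ^ j) \<noteq> 0" using w by (smt (verit) mult_pos_pos)
    then show ?thesis unfolding ratio_bound_def by (intro tendsto_intros r_lim)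
  qed
  have ev: "\<forall>\<^sub>F n in sequentially. ratio_bound w (r l n) < T"
    "\<forall>\<^sub>F n in sequentially. ratio_bound w (r (Suc l) n) < T"
    "\<forall>\<^sub>F n in sequentially. r l n < 2 / (1 - w)" "\<forall>\<^sub>F n in sequentially. 2 / (1 - w) < r (Suc l) n"
    using order_tendstoD[OF rb_lim[OF l]] order_tendstoD[OF rb_lim, of "Suc l"]
      order_tendstoD[OF r_lim[of l]] order_tendstoD[OF r_lim[of "Suc l"]] T win by simp_all
  show ?thesis
    using ev eventually_ge_at_top[of 1]
  proof eventually_elim
    case (elim n)
    show ?case
    proof (intro allI impI)
      fix m assume m: "n < m"
      have an: "0 < a n" using pos elim by simp
      have le: "real (a i) / real (a n) \<le> real (a j) / real (a n)" if "n < i" "i \<le> j" for i j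
        using mono[of i j] that elim by (cases "i = j") (auto intro!: divide_right_mono simp: less_imp_le)
      show "ratio_bound w (real (a m) / real (a n)) \<le> T"
      proof (cases "m \<le> n + l")
        case True
        have "1 < real (a m) / real (a n)" using mono[of n m] m elim an by simp
        moreover have "real (a m) / real (a n) \<le> r l n" using le[of m "n + l"] True m by (simp add: r_def)
        ultimately have "ratio_bound w (real (a m) / real (a n)) \<le> ratio_bound w (r l n)"
          using elim w by (intro ratio_bound_mono) auto
        then show ?thesis using elim by simp
      next
        case False
        then have "r (Suc l) n \<le> real (a m) / real (a n)" using le[of "n + Suc l" m] by (simp add: r_def)
        then have "ratio_bound w (real (a m) / real (a n)) \<le> ratio_bound w (r (Suc l) n)"
          using elim w by (intro ratio_bound_antimono) auto
        then show ?thesis using elim by simp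
      qed
    qed
  qed
qed

text \<open>The quotient \<open>\<sigma>\<close> of partial sum by last term satisfies
  \<open>\<sigma> (Suc k) = 1 + \<sigma> k / q\<close>. At a bad stage \<open>\<sigma> k\<close>
  lies below the fixed point \<open>q / (q - 1)\<close> by a margin, so \<open>\<sigma>\<close>
  grows; yet badness also keeps \<open>w * \<sigma> k\<close> at most 1.\<close>

lemma infinitely_many_good_indices:
  fixes y :: "nat \<Rightarrow> real" and w T T' \<rho> :: real
  assumes w: "0 < w" and T: "0 < T" "T' < T" and \<rho>: "1 < \<rho>" and y: "\<And>k. 0 < y k"
    and ev: "\<forall>\<^sub>F k in sequentially. \<rho> \<le> y (Suc k) / y k \<and> ratio_bound w (y (Suc k) / y k) \<le> T'"
  shows "\<exists>\<^sub>\<infinity>k. y k - w * (\<Sum>i\<le>k. y i) < T * (y k + w * y (Suc k))"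
proof (rule ccontr)
  assume "\<not> ?thesis"
  then have "\<forall>\<^sub>F k in sequentially. T * (y k + w * y (Suc k)) \<le> y k - w * (\<Sum>i\<le>k. y i)"
    by (simp add: frequently_def not_less cofinite_eq_sequentially)
  from eventually_conj[OF ev this] obtain K where K: "\<And>k. K \<le> k \<Longrightarrow> \<rho> \<le> y (Suc k) / y k"
    "\<And>k. K \<le> k \<Longrightarrow> ratio_bound w (y (Suc k) / y k) \<le> T'"
    "\<And>k. K \<le> k \<Longrightarrow> T * (y k + w * y (Suc k)) \<le> y k - w * (\<Sum>i\<le>k. y i)"
    unfolding eventually_sequentially by auto
  define \<sigma> where "\<sigma> k = (\<Sum>i\<le>k. y i) / y k" for k
  \<comment> \<open>At a bad stage \<open>w * \<sigma>\<close> increases by at least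
    \<open>(T - T') * (1 - 1 / q)\<close>; \<open>\<rho> \<le> q\<close> keeps this away from
    0.\<close>
  define \<delta> where "\<delta> = (T - T') * (1 - 1 / \<rho>)"
  have \<delta>: "0 < \<delta>" using T \<rho> by (simp add: \<delta>_def)
  have \<sigma>0: "0 \<le> \<sigma> k" for k
    unfolding \<sigma>_def using y by (intro divide_nonneg_nonneg sum_nonneg less_imp_le)
  have step: "w * \<sigma> k + \<delta> \<le> w * \<sigma> (Suc k)" and bdd: "w * \<sigma> k \<le> 1" if k: "K \<le> k" for k
  proof -
    define q where "q = y (Suc k) / y k"
    have q: "\<rho> \<le> q" "1 < q" using K(1)[OF k] \<rho> by (auto simp: q_def)
    have wq: "0 < w * q" using w q by simp
    have \<sigma>q: "\<sigma> (Suc k) = 1 + \<sigma> k / q"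
      using y[of k] y[of "Suc k"] by (simp add: \<sigma>_def q_def field_simps)
    have bad: "T * (1 + w * q) \<le> 1 - w * \<sigma> k"
    proof -
      have "(y k + w * y (Suc k)) / y k = 1 + w * q" "(y k - w * (\<Sum>i\<le>k. y i)) / y k = 1 - w * \<sigma> k"
        using y[of k] by (simp_all add: q_def \<sigma>_def field_simps)
      moreover have "T * ((y k + w * y (Suc k)) / y k) \<le> (y k - w * (\<Sum>i\<le>k. y i)) / y k"
        using divide_right_mono[OF K(3)[OF k], of "y k"] y[of k] by simp
      ultimately show ?thesis by simp
    qed
    moreover have "0 < T * (1 + w * q)" using T wq by simp
    ultimately show "w * \<sigma> k \<le> 1" by linarith
    have "(1 - w) * q - 1 \<le> T' * ((q - 1) * (1 + w * q))"
      using K(2)[OF k] q wq unfolding ratio_bound_def q_def[symmetric] by (simp add: pos_divide_le_eq)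
    moreover have "T * (1 + w * q) * (q - 1) \<le> (1 - w * \<sigma> k) * (q - 1)"
      using bad q by (intro mult_right_mono) auto
    \<comment> \<open>The right side is
      \<open>q * (w * \<sigma> (Suc k) - w * \<sigma> k)\<close>.\<close>
    ultimately have main: "(T - T') * (1 + w * q) * (q - 1) \<le> w * q - w * \<sigma> k * (q - 1)"
      by (simp add: algebra_simps)
    have "(T - T') * 1 * (q - 1) \<le> (T - T') * (1 + w * q) * (q - 1)"
      using T q wq by (intro mult_right_mono mult_left_mono) auto
    with main have "(T - T') * (q - 1) \<le> w * q - w * \<sigma> k * (q - 1)" by simp
    then have "(T - T') * (q - 1) / q \<le> (w * q - w * \<sigma> k * (q - 1)) / q"
      using q by (intro divide_right_mono) auto
    also have "\<dots> = w * \<sigma> (Suc k) - w * \<sigma> k" using q by (simp add: \<sigma>q field_simps)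
    finally have "(T - T') * (1 - 1 / q) \<le> w * \<sigma> (Suc k) - w * \<sigma> k" using q by (simp add: field_simps)
    moreover have "\<delta> \<le> (T - T') * (1 - 1 / q)"
      unfolding \<delta>_def using T q \<rho> by (intro mult_left_mono) (auto simp: frac_le)
    ultimately show "w * \<sigma> k + \<delta> \<le> w * \<sigma> (Suc k)" by simp
  qed
  have "real j * \<delta> \<le> w * \<sigma> (K + j)" for j
  proof (induction j)
    case 0
    then show ?case using w \<sigma>0 by simp
  next
    case (Suc j)
    then show ?case using step[of "K + j"] by (simp add: algebra_simps)
  qed
  then have "real j * \<delta> \<le> 1" for j using bdd[of "K + j"] by (meson le_add1 order_trans)
  then show False using \<delta> by (meson ex_less_of_nat_mult not_le)
qed

section \<open>Covers by chains of approximations\<close>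

lemma card_ints_near:
  fixes c R :: real
  assumes "0 \<le> R"
  shows "finite {q :: int. \<bar>real_of_int q - c\<bar> \<le> R}"
    and "real (card {q :: int. \<bar>real_of_int q - c\<bar> \<le> R}) \<le> 2 * R + 1"
proof -
  have eq: "{q :: int. \<bar>real_of_int q - c\<bar> \<le> R} = {\<lceil>c - R\<rceil>..\<lfloor>c + R\<rfloor>}"
    by (auto simp: abs_le_iff ceiling_le_iff le_floor_iff)
  show "finite {q :: int. \<bar>real_of_int q - c\<bar> \<le> R}" by (simp add: eq)
  show "real (card {q :: int. \<bar>real_of_int q - c\<bar> \<le> R}) \<le> 2 * R + 1"
    unfolding eq using assms by simp linarith
qed

text \<open>\<open>reach \<beta> x w p ns\<close> are the numerators available at \<open>hd ns\<close> to a chain of approximations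
  \<open>q / \<beta> powr x n\<close> whose indices, latest first, are \<open>ns\<close> and whose first numerator is \<open>p\<close>.\<close>

fun reach :: "real \<Rightarrow> (nat \<Rightarrow> real) \<Rightarrow> real \<Rightarrow> int \<Rightarrow> nat list \<Rightarrow> int set" where
  "reach \<beta> x w p [] = {}"
| "reach \<beta> x w p [n] = {p}"
| "reach \<beta> x w p (n' # n # ns) =
     (if 1 / 2 \<le> \<beta> powr (x n' - x n - w * x n')
      then \<Union>q\<in>reach \<beta> x w p (n # ns).
        {q'. \<bar>real_of_int q' / \<beta> powr x n' - real_of_int q / \<beta> powr x n\<bar>
               \<le> \<beta> powr - (x n + w * x n') + \<beta> powr - x n' / 2}
      else {})"

text \<open>Each new index multiplies the count by at most \<open>6 * B\<close>, and the exponents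
  \<open>x n' - x n - w * x n'\<close> telescope. A single index needs
  \<open>w \<le> 1\<close>.\<close>

lemma card_reach:
  fixes \<beta> w :: real
  assumes \<beta>: "1 < \<beta>" and w: "w \<le> 1" and x: "\<And>n. 0 \<le> x n"
  shows "finite (reach \<beta> x w p ns)"
    and "ns \<noteq> [] \<Longrightarrow> real (card (reach \<beta> x w p ns))
      \<le> 6 ^ length ns * \<beta> powr (x (hd ns) - w * sum_list (map x ns))"
proof -
  have "finite (reach \<beta> x w p ns) \<and> (ns \<noteq> [] \<longrightarrow> real (card (reach \<beta> x w p ns))
      \<le> 6 ^ length ns * \<beta> powr (x (hd ns) - w * sum_list (map x ns)))"
  proof (induction ns rule: induct_list012)
    case (2 n)
    have "1 \<le> \<beta> powr (x n - w * x n)"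
      using \<beta> w x[of n] mult_right_mono[OF w x, of n] by (intro ge_one_powr_ge_zero) auto
    then show ?case by simp
  next
    case (3 n' n ns)
    define B where "B = \<beta> powr (x n' - x n - w * x n')"
    define S where "S q = {q'. \<bar>real_of_int q' / \<beta> powr x n' - real_of_int q / \<beta> powr x n\<bar>
               \<le> \<beta> powr - (x n + w * x n') + \<beta> powr - x n' / 2}" for q :: int
    let ?R = "reach \<beta> x w p (n # ns)"
    have eq: "reach \<beta> x w p (n' # n # ns) = (if 1 / 2 \<le> B then \<Union>q\<in>?R. S q else {})"
      by (simp add: B_def S_def)
    show ?case
    proof (cases "1 / 2 \<le> B")
      case True
      have S_eq: "S q = {q'. \<bar>real_of_int q' - real_of_int q * \<beta> powr (x n' - x n)\<bar> \<le> B + 1 / 2}" for q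
      proof -
        have "\<bar>real_of_int q' / \<beta> powr x n' - real_of_int q / \<beta> powr x n\<bar>
            \<le> \<beta> powr - (x n + w * x n') + \<beta> powr - x n' / 2 \<longleftrightarrow>
          \<bar>real_of_int q' - real_of_int q * \<beta> powr (x n' - x n)\<bar> \<le> B + 1 / 2" for q'
        proof -
          have 1: "\<beta> powr x n' * \<bar>real_of_int q' / \<beta> powr x n' - real_of_int q / \<beta> powr x n\<bar>
            = \<bar>real_of_int q' - real_of_int q * \<beta> powr (x n' - x n)\<bar>"
          proof -
            have "\<beta> powr x n' * \<bar>real_of_int q' / \<beta> powr x n' - real_of_int q / \<beta> powr x n\<bar>
              = \<bar>\<beta> powr x n' * (real_of_int q' / \<beta> powr x n' - real_of_int q / \<beta> powr x n)\<bar>"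
              by (simp add: abs_mult)
            also have "\<beta> powr x n' * (real_of_int q' / \<beta> powr x n' - real_of_int q / \<beta> powr x n)
              = real_of_int q' - real_of_int q * \<beta> powr (x n' - x n)"
              using \<beta> by (simp add: algebra_simps powr_diff)
            finally show ?thesis .
          qed
          have 2: "\<beta> powr x n' * (\<beta> powr - (x n + w * x n') + \<beta> powr - x n' / 2) = B + 1 / 2"
            using \<beta> by (simp add: B_def algebra_simps powr_add powr_diff powr_minus divide_simps)
          have "0 < \<beta> powr x n'" using \<beta> by simp
          then show ?thesis unfolding 1[symmetric] 2[symmetric] by (simp only: mult_le_cancel_left_pos)
        qed
        then show ?thesis by (simp add: S_def)
      qed
      have B0: "0 \<le> B + 1 / 2" using True by simp
      \<comment> \<open>Radius \<open>B + 1 / 2\<close> allows at most \<open>2 * B + 2\<close>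
        integers, and \<open>1 / 2 \<le> B\<close> turns this into \<open>6 * B\<close>.\<close>
      have Sfin: "finite (S q)" and Scard: "real (card (S q)) \<le> 6 * B" for q
        using card_ints_near[OF B0, of "real_of_int q * \<beta> powr (x n' - x n)"] True
        unfolding S_eq by simp_all
      have "real (card (\<Union>q\<in>?R. S q)) \<le> real (\<Sum>q\<in>?R. card (S q))"
        using 3 by (intro of_nat_mono card_UN_le) auto
      also have "\<dots> \<le> (\<Sum>q\<in>?R. 6 * B)" unfolding of_nat_sum by (intro sum_mono Scard)
      also have "\<dots> = real (card ?R) * (6 * B)" by simp
      also have "\<dots> \<le> 6 ^ length (n # ns) * \<beta> powr (x n - w * sum_list (map x (n # ns))) * (6 * B)"
        using 3 True by (intro mult_right_mono) auto
      also have "\<dots> = 6 ^ length (n' # n # ns) * \<beta> powr (x n' - w * sum_list (map x (n' # n # ns)))"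
        by (simp add: B_def powr_add[symmetric] algebra_simps)
      finally show ?thesis using True Sfin 3 by (simp add: eq del: reach.simps)
    qed (simp add: eq del: reach.simps)
  qed simp
  then show "finite (reach \<beta> x w p ns)" "ns \<noteq> [] \<Longrightarrow> real (card (reach \<beta> x w p ns))
      \<le> 6 ^ length ns * \<beta> powr (x (hd ns) - w * sum_list (map x ns))" by auto
qed

text \<open>Numerators at \<open>N k\<close> and \<open>N (Suc k)\<close> are compared by the first
  bound at the former and the second at the latter, so \<open>reach\<close> never needs the index
  after \<open>N (Suc k)\<close>. The third clause absorbs the additive constant when integers are
  counted.\<close>

definition approx_chain ::
  "real \<Rightarrow> (nat \<Rightarrow> real) \<Rightarrow> real \<Rightarrow> (nat \<Rightarrow> nat) \<Rightarrow> (nat \<Rightarrow> int) \<Rightarrow> real \<Rightarrow> bool" where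
  "approx_chain \<beta> x w N q \<xi> \<longleftrightarrow> strict_mono N \<and> (\<forall>k.
     \<bar>\<xi> - real_of_int (q k) / \<beta> powr x (N k)\<bar> \<le> \<beta> powr - (x (N k) + w * x (N (Suc k))) \<and>
     \<bar>\<xi> - real_of_int (q k) / \<beta> powr x (N k)\<bar> \<le> \<beta> powr - x (N k) / 2 \<and>
     1 / 2 \<le> \<beta> powr (x (N (Suc k)) - x (N k) - w * x (N (Suc k))))"

text \<open>The radius at the stage \<open>hd ns\<close> depends on the next index \<open>n\<close>,
  so the lists are grouped by \<open>n\<close>. The inequality says that the stage is good.\<close>

definition good_lists :: "(nat \<Rightarrow> real) \<Rightarrow> real \<Rightarrow> real \<Rightarrow> nat \<Rightarrow> nat list set" where
  "good_lists x w T n = {ns. sorted_wrt (>) (n # ns) \<and> ns \<noteq> [] \<and>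
     x (hd ns) - w * sum_list (map x ns) < T * (x (hd ns) + w * x n)}"

text \<open>A strictly decreasing list is determined by its set, here a subset of
  \<open>{..<n}\<close>.\<close>

lemma good_lists_finite_card:
  "finite (good_lists x w T n)" "card (good_lists x w T n) \<le> 2 ^ n"
  "ns \<in> good_lists x w T n \<Longrightarrow> length ns \<le> n"
proof -
  let ?L = "good_lists x w T n"
  have inj: "inj_on set ?L"
  proof (rule inj_onI)
    fix ns ms assume "ns \<in> ?L" "ms \<in> ?L" "set ns = set ms"
    then have "sorted_wrt (<) (rev ns)" "sorted_wrt (<) (rev ms)" "set (rev ms) = set (rev ns)"
      by (auto simp: good_lists_def sorted_wrt_rev)
    then have "rev ms = rev ns" by (metis strict_sorted_equal)
    then show "ns = ms" by simp
  qed
  have sub: "set ` ?L \<subseteq> Pow {..<n}" by (auto simp: good_lists_def)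
  show "finite ?L" using inj sub by (metis finite_Pow_iff finite_imageD finite_lessThan finite_subset)
  have "card ?L = card (set ` ?L)" using inj by (simp add: card_image)
  also have "\<dots> \<le> card (Pow {..<n})" using sub by (intro card_mono) auto
  finally show "card ?L \<le> 2 ^ n" by (simp add: card_Pow)
  assume ns: "ns \<in> ?L"
  then have "sorted_wrt (<) (rev ns)" by (auto simp: good_lists_def sorted_wrt_rev)
  then have "distinct (rev ns)" by (simp add: strict_sorted_iff)
  then have "distinct ns" by simp
  then have "length ns = card (set ns)" by (simp add: distinct_card)
  also have "\<dots> \<le> card {..<n}" using ns sub by (intro card_mono) auto
  finally show "length ns \<le> n" by simp
qed

text \<open>The limsup lemma is applied to the sets \<open>A n\<close> formed by the balls of all
  good stages with next index \<open>n\<close>. The factor \<open>12 ^ n\<close> combines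
  \<open>2 ^ n\<close> lists with the \<open>6 ^ n\<close> of \<open>card_reach\<close>; fixing the
  first numerator \<open>p\<close> makes each \<open>reach\<close> finite.\<close>

lemma hausdorff_content_chains_eq_0:
  fixes \<beta> w s T :: real and x :: "nat \<Rightarrow> real"
  assumes \<beta>: "1 < \<beta>" and w: "0 < w" "w < 1" and T: "0 < T" "T < s" and x: "\<And>n. 0 \<le> x n"
    and sm: "summable (\<lambda>n. 12 ^ n * \<beta> powr (- ((s - T) * w * x n)))"
    and E: "\<And>\<xi>. \<xi> \<in> E \<Longrightarrow> \<exists>N q. approx_chain \<beta> x w N q \<xi> \<and> q 0 = p \<and>
      (\<exists>\<^sub>\<infinity>k. x (N k) - w * (\<Sum>i\<le>k. x (N i)) < T * (x (N k) + w * x (N (Suc k))))"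
  shows "hausdorff_content s E = 0"
proof -
  define rad where "rad n ns = \<beta> powr - (x (hd ns) + w * x n)" for n ns
  define A where "A n = (\<Union>ns\<in>good_lists x w T n. \<Union>q\<in>reach \<beta> x w p ns.
    cball (real_of_int q / \<beta> powr x (hd ns)) (rad n ns))" for n
  define t where "t n = 2 powr s * (12 ^ n * \<beta> powr (- ((s - T) * w * x n)))" for n
  show ?thesis
  proof (rule hausdorff_content_limsup_eq_0)
    show "0 \<le> t n" for n by (simp add: t_def)
    show "summable t" unfolding t_def by (intro summable_mult sm)
  next
    fix n
    let ?L = "good_lists x w T n"
    have "hausdorff_content s (A n) \<le> (\<Sum>ns\<in>?L. hausdorff_content s (\<Union>q\<in>reach \<beta> x w p ns.
        cball (real_of_int q / \<beta> powr x (hd ns)) (rad n ns)))"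
      unfolding A_def by (intro hausdorff_content_finite_UN good_lists_finite_card)
    also have "\<dots> \<le> (\<Sum>ns\<in>?L. ennreal (2 powr s * (6 ^ n * \<beta> powr (- ((s - T) * w * x n)))))"
    proof (rule sum_mono)
      fix ns assume ns: "ns \<in> ?L"
      then have ne: "ns \<noteq> []" by (simp add: good_lists_def)
      have rad: "0 < rad n ns" using \<beta> by (simp add: rad_def)
      have "hausdorff_content s (\<Union>q\<in>reach \<beta> x w p ns.
          cball (real_of_int q / \<beta> powr x (hd ns)) (rad n ns))
        \<le> (\<Sum>q\<in>reach \<beta> x w p ns. hausdorff_content s (cball (real_of_int q / \<beta> powr x (hd ns)) (rad n ns)))"
        using \<beta> w x by (intro hausdorff_content_finite_UN card_reach) auto
      also have "\<dots> \<le> (\<Sum>q\<in>reach \<beta> x w p ns. ennreal ((2 * rad n ns) powr s))"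
      proof (rule sum_mono)
        fix q
        have "hausdorff_content s (cball (real_of_int q / \<beta> powr x (hd ns)) (rad n ns))
          \<le> diam_pow s (cball (real_of_int q / \<beta> powr x (hd ns)) (rad n ns))"
          by (intro hausdorff_content_le_diam_pow) auto
        also have "\<dots> = ennreal ((2 * rad n ns) powr s)"
          using T rad by (simp add: diam_pow_def not_less)
        finally show "hausdorff_content s (cball (real_of_int q / \<beta> powr x (hd ns)) (rad n ns))
          \<le> ennreal ((2 * rad n ns) powr s)" .
      qed
      also have "\<dots> = ennreal (real (card (reach \<beta> x w p ns)) * (2 * rad n ns) powr s)"
        by (simp add: ennreal_mult ennreal_of_nat_eq_real_of_nat)
      also have "\<dots> \<le> ennreal (2 powr s * (6 ^ n * \<beta> powr (- ((s - T) * w * x n))))"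
      proof (rule ennreal_leI)
        let ?e = "x (hd ns) - w * sum_list (map x ns)"
        \<comment> \<open>A good stage gives the bound
          \<open>- (s - T) * (x (hd ns) + w * x n)\<close>; dropping \<open>x (hd ns)\<close> leaves
          one common to all lists.\<close>
        have e: "?e + - (s * (x (hd ns) + w * x n)) \<le> - ((s - T) * w * x n)"
        proof -
          have "?e < T * (x (hd ns) + w * x n)" using ns by (simp add: good_lists_def)
          moreover have "0 \<le> (s - T) * x (hd ns)" using T x by simp
          ultimately show ?thesis by (simp add: algebra_simps)
        qed
        have "real (card (reach \<beta> x w p ns)) * (2 * rad n ns) powr s
            \<le> (6 ^ length ns * \<beta> powr ?e) * (2 * rad n ns) powr s"
          using card_reach(2)[where w = w and x = x and p = p, OF \<beta> less_imp_le[OF w(2)] x ne] by (intro mult_right_mono) auto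
        also have "\<dots> = 2 powr s * (6 ^ length ns * \<beta> powr (?e + - (s * (x (hd ns) + w * x n))))"
        proof -
          have "rad n ns powr s = \<beta> powr - (s * (x (hd ns) + w * x n))"
            by (simp add: rad_def powr_powr algebra_simps)
          then show ?thesis using rad by (simp only: powr_mult powr_add mult_ac)
        qed
        also have "\<dots> \<le> 2 powr s * (6 ^ n * \<beta> powr (- ((s - T) * w * x n)))"
          using e \<beta> good_lists_finite_card(3)[OF ns]
          by (intro mult_mono power_increasing powr_mono mult_nonneg_nonneg) auto
        finally show "real (card (reach \<beta> x w p ns)) * (2 * rad n ns) powr s
          \<le> 2 powr s * (6 ^ n * \<beta> powr (- ((s - T) * w * x n)))" .
      qed
      finally show "hausdorff_content s (\<Union>q\<in>reach \<beta> x w p ns.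
          cball (real_of_int q / \<beta> powr x (hd ns)) (rad n ns))
        \<le> ennreal (2 powr s * (6 ^ n * \<beta> powr (- ((s - T) * w * x n))))" .
    qed
    also have "\<dots> = ennreal (real (card ?L) * (2 powr s * (6 ^ n * \<beta> powr (- ((s - T) * w * x n)))))"
      by (simp add: ennreal_mult ennreal_of_nat_eq_real_of_nat)
    also have "\<dots> \<le> ennreal (2 ^ n * (2 powr s * (6 ^ n * \<beta> powr (- ((s - T) * w * x n)))))"
    proof (intro ennreal_leI mult_right_mono)
      have "real (card ?L) \<le> real (2 ^ n)" by (intro of_nat_mono good_lists_finite_card)
      then show "real (card ?L) \<le> 2 ^ n" by simp
    qed auto
    also have "2 ^ n * (2 powr s * (6 ^ n * \<beta> powr (- ((s - T) * w * x n)))) = t n"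
      by (simp add: t_def power_mult_distrib[symmetric])
    finally show "hausdorff_content s (A n) \<le> ennreal (t n)" .
  next
    fix \<xi> assume "\<xi> \<in> E"
    from E[OF this] obtain N q where chain: "approx_chain \<beta> x w N q \<xi>" and q0: "q 0 = p"
      and inf: "\<exists>\<^sub>\<infinity>k. x (N k) - w * (\<Sum>i\<le>k. x (N i)) < T * (x (N k) + w * x (N (Suc k)))"
      by blast
    have mono: "strict_mono N"
      and near: "\<And>k. \<bar>\<xi> - real_of_int (q k) / \<beta> powr x (N k)\<bar> \<le> \<beta> powr - (x (N k) + w * x (N (Suc k)))"
        "\<And>k. \<bar>\<xi> - real_of_int (q k) / \<beta> powr x (N k)\<bar> \<le> \<beta> powr - x (N k) / 2"
      and gap: "\<And>k. 1 / 2 \<le> \<beta> powr (x (N (Suc k)) - x (N k) - w * x (N (Suc k)))"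
      using chain by (auto simp: approx_chain_def)
    define ls where "ls k = map N (rev [0..<Suc k])" for k
    have ls_Suc: "ls (Suc k) = N (Suc k) # ls k" for k by (simp add: ls_def)
    have ls_Cons: "\<exists>ms. ls k = N k # ms" for k by (simp add: ls_def)
    have ls_sorted: "sorted_wrt (>) (ls k)" for k
      unfolding ls_def sorted_wrt_map sorted_wrt_rev
      using mono by (auto simp: sorted_wrt_iff_nth_less strict_mono_less simp del: upt_Suc)
    have ls_sum: "sum_list (map x (ls k)) = (\<Sum>i\<le>k. x (N i))" for k
      by (induction k) (simp_all add: ls_Suc, simp add: ls_def)
    have ls_reach: "q k \<in> reach \<beta> x w p (ls k)" for k
    proof (induction k)
      case 0
      then show ?case by (simp add: ls_def q0)
    next
      case (Suc k)
      obtain ms where ms: "ls k = N k # ms" using ls_Cons by blast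
      have "\<bar>real_of_int (q (Suc k)) / \<beta> powr x (N (Suc k)) - real_of_int (q k) / \<beta> powr x (N k)\<bar>
          \<le> \<beta> powr - (x (N k) + w * x (N (Suc k))) + \<beta> powr - x (N (Suc k)) / 2"
        using near(1)[of k] near(2)[of "Suc k"] by linarith
      then show ?case using Suc gap[of k] by (auto simp: ls_Suc ms)
    qed
    have mem: "\<xi> \<in> A (N (Suc k))" if "x (N k) - w * (\<Sum>i\<le>k. x (N i)) < T * (x (N k) + w * x (N (Suc k)))" for k
    proof -
      have hd: "hd (ls k) = N k" "ls k \<noteq> []" using ls_Cons[of k] by auto
      have "ls k \<in> good_lists x w T (N (Suc k))"
        using ls_sorted[of "Suc k"] that hd by (simp add: good_lists_def ls_Suc ls_sum)
      moreover have "\<xi> \<in> cball (real_of_int (q k) / \<beta> powr x (hd (ls k))) (rad (N (Suc k)) (ls k))"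
        using near(1)[of k] by (simp add: hd rad_def dist_real_def abs_minus_commute)
      ultimately show ?thesis using ls_reach[of k] unfolding A_def by blast
    qed
    show "\<exists>\<^sub>\<infinity>n. \<xi> \<in> A n"
      unfolding INFM_nat_le
    proof
      fix n
      obtain k where "k \<ge> n" and k: "x (N k) - w * (\<Sum>i\<le>k. x (N i)) < T * (x (N k) + w * x (N (Suc k)))"
        using inf unfolding INFM_nat_le by blast
      moreover have "Suc k \<le> N (Suc k)" using mono by (rule strict_mono_imp_increasing)
      ultimately show "\<exists>m\<ge>n. \<xi> \<in> A m" using mem[OF k] by (intro exI[of _ "N (Suc k)"]) simp
    qed
  qed
qed

section \<open>Approximation chains of points with a large uniform exponent\<close>

text \<open>The \<open>N k\<close> below are the successive indices at which the sequence \<open>\<delta>\<close> attains a new minimum.\<close>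

lemma record_indices:
  fixes \<delta> g :: "nat \<Rightarrow> real"
  assumes pos: "\<And>n. 1 \<le> n \<Longrightarrow> 0 < \<delta> n" and g: "g \<longlonglongrightarrow> 0"
    and lt: "\<forall>\<^sub>F N in sequentially. Min (\<delta> ` {1..N}) < g N"
  obtains N :: "nat \<Rightarrow> nat" where "strict_mono N" "\<And>k. 1 \<le> N k"
    "\<And>k. \<delta> (N (Suc k)) < \<delta> (N k)" "\<And>k. \<delta> (N k) < g (N (Suc k) - 1)"
proof -
  from lt obtain M where M: "1 \<le> M" "\<And>N. M \<le> N \<Longrightarrow> Min (\<delta> ` {1..N}) < g N"
    unfolding eventually_sequentially by (metis le_trans nat_le_linear)
  \<comment> \<open>Testing up to \<open>max n M\<close> puts the next smaller value beyond
    \<open>M\<close>, so that the bound on \<open>Min\<close> is available just before it.\<close>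
  define rec where "rec n \<longleftrightarrow> 1 \<le> n \<and> (\<forall>i\<in>{1..max n M}. \<delta> n \<le> \<delta> i)" for n
  have "\<exists>N. \<forall>k. rec (N k) \<and> N k < N (Suc k) \<and> \<delta> (N (Suc k)) < \<delta> (N k) \<and> \<delta> (N k) < g (N (Suc k) - 1)"
  proof (rule dependent_nat_choice[where P = "\<lambda>_. rec" and
        Q = "\<lambda>_ n n'. n < n' \<and> \<delta> n' < \<delta> n \<and> \<delta> n < g (n' - 1)"])
    have "Min (\<delta> ` {1..M}) \<in> \<delta> ` {1..M}" using M by (intro Min_in) auto
    then obtain n where n: "n \<in> {1..M}" "\<delta> n = Min (\<delta> ` {1..M})" by auto
    have "rec n" unfolding rec_def
    proof (intro conjI ballI)
      fix i assume "i \<in> {1..max n M}"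
      then have "i \<in> {1..M}" using n(1) by auto
      then show "\<delta> n \<le> \<delta> i" unfolding n(2) by (intro Min_le) auto
    qed (use n in simp)
    then show "\<exists>n. rec n" ..
  next
    fix n assume n: "rec n"
    have \<delta>n: "0 < \<delta> n" using n pos by (simp add: rec_def)
    \<comment> \<open>As \<open>g\<close> tends to 0 and \<open>\<delta> n\<close> is positive, the
      minimum eventually drops below \<open>\<delta> n\<close>: records never stop.\<close>
    have ex: "\<exists>n'. 1 \<le> n' \<and> \<delta> n' < \<delta> n"
    proof -
      obtain L where L: "\<And>N. L \<le> N \<Longrightarrow> g N < \<delta> n"
        using order_tendstoD(2)[OF g \<delta>n] unfolding eventually_sequentially by blast
      have "Min (\<delta> ` {1..max L M}) \<in> \<delta> ` {1..max L M}" using M by (intro Min_in) auto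
      then obtain i where i: "i \<in> {1..max L M}" "\<delta> i = Min (\<delta> ` {1..max L M})" by auto
      have "\<delta> i < \<delta> n" using M(2)[of "max L M"] L[of "max L M"] i(2) by simp
      then show ?thesis using i(1) by auto
    qed
    define n' where "n' = (LEAST n'. 1 \<le> n' \<and> \<delta> n' < \<delta> n)"
    have n': "1 \<le> n'" "\<delta> n' < \<delta> n" using LeastI_ex[OF ex] by (auto simp: n'_def)
    have least: "\<delta> n \<le> \<delta> i" if "1 \<le> i" "i < n'" for i
      using not_less_Least[of i "\<lambda>n'. 1 \<le> n' \<and> \<delta> n' < \<delta> n"] that by (auto simp: n'_def not_less)
    have gt: "max n M < n'"
    proof (rule ccontr)
      assume "\<not> ?thesis"
      then have "\<delta> n \<le> \<delta> n'" using n n'(1) by (auto simp: rec_def)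
      then show False using n'(2) by simp
    qed
    have "rec n'" unfolding rec_def
    proof (intro conjI ballI)
      fix i assume "i \<in> {1..max n' M}"
      then have "1 \<le> i" "i \<le> n'" using gt by auto
      then show "\<delta> n' \<le> \<delta> i" using least[of i] n'(2) by (cases "i = n'") auto
    qed (use n' in simp)
    moreover have "\<delta> n < g (n' - 1)"
    proof -
      have "Min (\<delta> ` {1..n' - 1}) \<in> \<delta> ` {1..n' - 1}" using gt M by (intro Min_in) auto
      then obtain i where i: "i \<in> {1..n' - 1}" "\<delta> i = Min (\<delta> ` {1..n' - 1})" by auto
      have "\<delta> n \<le> \<delta> i" using i(1) by (intro least) auto
      moreover have "M \<le> n' - 1" using gt by auto
      ultimately show ?thesis using M(2)[of "n' - 1"] i(2) by simp
    qed
    ultimately show "\<exists>n'. rec n' \<and> n < n' \<and> \<delta> n' < \<delta> n \<and> \<delta> n < g (n' - 1)"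
      using gt n' by auto
  qed
  then obtain N where "\<And>k. rec (N k) \<and> N k < N (Suc k) \<and> \<delta> (N (Suc k)) < \<delta> (N k) \<and> \<delta> (N k) < g (N (Suc k) - 1)"
    by blast
  then show ?thesis using that[of N] by (auto simp: strict_mono_Suc_iff rec_def)
qed

lemma dist_nearest_int_attained:
  obtains q :: int where "dist_nearest_int y = \<bar>y - real_of_int q\<bar>"
proof -
  have "closed (\<int> :: real set)" "(\<int> :: real set) \<noteq> {}" by auto
  from infdist_attains_inf[OF this, of y] show ?thesis
    using that unfolding dist_nearest_int_def dist_real_def by (metis Ints_cases)
qed

lemma dist_nearest_int_le: "dist_nearest_int y \<le> \<bar>y - real_of_int q\<bar>"
  unfolding dist_nearest_int_def using infdist_le[of "real_of_int q" \<int> y] by (simp add: dist_real_def)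

lemma dist_nearest_int_le_half: "dist_nearest_int y \<le> 1 / 2"
  using dist_nearest_int_le[of y "round y"] of_int_round_abs_le[of y] by (simp add: abs_minus_commute)

text \<open>The chain takes the record indices, with nearest integers as numerators. The hypothesis
  \<open>ev\<close> carries \<open>a (Suc N)\<close> because it is used at the last index before a
  record, where \<open>Suc N\<close> is the record itself.\<close>

lemma approx_chain_exists:
  fixes b :: nat and a :: "nat \<Rightarrow> nat" and w \<xi> :: real
  assumes b: "2 \<le> b" and w: "0 < w"
    and mono: "\<And>i j. 1 \<le> i \<Longrightarrow> i < j \<Longrightarrow> a i < a j"
    and pos: "\<And>n. 1 \<le> n \<Longrightarrow> 0 < dist_nearest_int (real b ^ a n * \<xi>)"
    and ev: "\<forall>\<^sub>F N in sequentially.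
      Min ((\<lambda>n. dist_nearest_int (real b ^ a n * \<xi>)) ` {1..N}) < real b powr - (w * real (a (Suc N)))"
  obtains N q where "approx_chain (real b) (\<lambda>n. real (a n)) w N q \<xi>" "\<And>k. 1 \<le> N k"
proof -
  define \<delta> where "\<delta> n = dist_nearest_int (real b ^ a n * \<xi>)" for n
  have b1: "1 < real b" using b by simp
  have a_ge: "N \<le> a (Suc N)" for N
  proof (induction N)
    case (Suc N)
    then show ?case using mono[of "Suc N" "Suc (Suc N)"] by simp
  qed simp
  have "real b powr - w < real b powr 0" using b1 w by (intro powr_less_mono) auto
  then have "(\<lambda>N. (real b powr - w) ^ N) \<longlonglongrightarrow> 0" using b1 by (intro LIMSEQ_realpow_zero) auto
  then have z: "(\<lambda>N. real b powr - (w * real N)) \<longlonglongrightarrow> 0"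
    using b1 by (simp add: powr_power mult.commute)
  have le: "real b powr - (w * real (a (Suc N))) \<le> real b powr - (w * real N)" for N
    using b1 w a_ge by (intro powr_mono) auto
  have lim: "(\<lambda>N. real b powr - (w * real (a (Suc N)))) \<longlonglongrightarrow> 0"
    by (rule real_tendsto_sandwich[OF _ _ tendsto_const z]) (simp_all add: le)
  obtain N where N: "strict_mono N" "\<And>k. 1 \<le> N k" "\<And>k. \<delta> (N (Suc k)) < \<delta> (N k)"
    and \<delta>N: "\<And>k. \<delta> (N k) < real b powr - (w * real (a (Suc (N (Suc k) - 1))))"
    by (rule record_indices[OF pos[folded \<delta>_def] lim ev[folded \<delta>_def]]) (assumption, rule that)
  have \<delta>lt: "\<delta> (N k) < real b powr - (w * real (a (N (Suc k))))" for k
    using \<delta>N[of k] N(2)[of "Suc k"] by simp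
  have "\<exists>q. \<delta> n = \<bar>real b ^ a n * \<xi> - real_of_int q\<bar>" for n
    using dist_nearest_int_attained[of "real b ^ a n * \<xi>"] unfolding \<delta>_def by blast
  then obtain p where p: "\<And>n. \<delta> n = \<bar>real b ^ a n * \<xi> - real_of_int (p n)\<bar>"
    by metis
  define x where "x n = real (a n)" for n
  have bx: "real b powr x n = real b ^ a n" "0 < real b powr x n" for n
    using b1 by (simp_all add: x_def powr_realpow)
  have err: "\<bar>\<xi> - real_of_int (p n) / real b powr x n\<bar> = \<delta> n * real b powr - x n" for n
  proof -
    have "\<delta> n * real b powr - x n = \<bar>(real b powr x n * \<xi> - real_of_int (p n)) / real b powr x n\<bar>"
      using bx(2)[of n] by (simp add: p bx(1)[symmetric] powr_minus divide_inverse abs_mult)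
    also have "(real b powr x n * \<xi> - real_of_int (p n)) / real b powr x n = \<xi> - real_of_int (p n) / real b powr x n"
      using bx(2)[of n] by (simp add: diff_divide_distrib)
    finally show ?thesis ..
  qed
  have near: "\<bar>\<xi> - real_of_int (p (N k)) / real b powr x (N k)\<bar> \<le> real b powr - (x (N k) + w * x (N (Suc k)))" for k
  proof -
    have "\<delta> (N k) * real b powr - x (N k) \<le> real b powr - (w * x (N (Suc k))) * real b powr - x (N k)"
      using \<delta>lt[of k] by (intro mult_right_mono) (auto simp: x_def)
    also have "\<dots> = real b powr - (x (N k) + w * x (N (Suc k)))"
      by (simp add: powr_add[symmetric] algebra_simps)
    finally show ?thesis by (simp add: err)
  qed
  have half: "\<bar>\<xi> - real_of_int (p n) / real b powr x n\<bar> \<le> real b powr - x n / 2" for n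
    using mult_right_mono[OF dist_nearest_int_le_half, of "real b powr - x n" "real b ^ a n * \<xi>"]
    by (simp add: err \<delta>_def)
  \<comment> \<open>Distinct fractions with denominator \<open>real b powr x ?m\<close> are at least
    \<open>real b powr - x ?m\<close> apart. The error at \<open>?m\<close> takes at most half of
    this, so the error bound at \<open>?n\<close> must cover the other half.\<close>
  have gap: "1 / 2 \<le> real b powr (x (N (Suc k)) - x (N k) - w * x (N (Suc k)))" for k
  proof -
    let ?n = "N k" and ?m = "N (Suc k)"
    have le: "a ?n \<le> a ?m" using mono[of ?n ?m] N(1) N(2)[of k] by (simp add: strict_mono_Suc_iff less_imp_le)
    define d where "d = real b ^ (a ?m - a ?n)"
    have d1: "1 \<le> d" using b1 by (simp add: d_def)
    have bd: "real b ^ a ?m = d * real b ^ a ?n" using le by (simp add: d_def power_add[symmetric])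
    text \<open>Equal fractions would make the error at \<open>?m\<close> a multiple \<open>d \<ge> 1\<close> of the error at \<open>?n\<close>.\<close>
    have ne: "real_of_int (p ?m) \<noteq> d * real_of_int (p ?n)"
    proof
      assume "real_of_int (p ?m) = d * real_of_int (p ?n)"
      then have "\<delta> ?m = \<bar>d * (real b ^ a ?n * \<xi> - real_of_int (p ?n))\<bar>"
        by (simp add: p bd algebra_simps)
      then have "\<delta> ?m = d * \<delta> ?n" using d1 by (simp add: p abs_mult)
      moreover have "1 * \<delta> ?n \<le> d * \<delta> ?n" using d1 by (intro mult_right_mono) (auto simp: p)
      ultimately show False using N(3)[of k] by simp
    qed
    have "real_of_int (p ?m) - d * real_of_int (p ?n) \<in> \<int>" by (simp add: d_def)
    then have "1 \<le> \<bar>real_of_int (p ?m) - d * real_of_int (p ?n)\<bar>"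
      using ne by (intro Ints_nonzero_abs_ge1) auto
    then have "real b powr - x ?m \<le> \<bar>real_of_int (p ?m) - d * real_of_int (p ?n)\<bar> * real b powr - x ?m"
      by (simp add: mult_le_cancel_right1)
    also have "\<dots> = \<bar>(real_of_int (p ?m) - d * real_of_int (p ?n)) / real b powr x ?m\<bar>"
      by (simp add: powr_minus divide_inverse abs_mult)
    also have "(real_of_int (p ?m) - d * real_of_int (p ?n)) / real b powr x ?m
        = real_of_int (p ?m) / real b powr x ?m - real_of_int (p ?n) / real b powr x ?n"
      using d1 b1 by (simp add: bx(1) bd diff_divide_distrib)
    also have "\<bar>\<dots>\<bar> \<le> real b powr - (x ?n + w * x ?m) + real b powr - x ?m / 2"
      using near[of k] half[of ?m] by linarith
    finally have "real b powr - x ?m / 2 \<le> real b powr - (x ?n + w * x ?m)" by simp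
    then have "real b powr x ?m * (real b powr - x ?m / 2) \<le> real b powr x ?m * real b powr - (x ?n + w * x ?m)"
      by (intro mult_left_mono) auto
    also have "real b powr x ?m * (real b powr - x ?m / 2) = 1 / 2"
      using bx(2)[of ?m] by (simp add: powr_minus)
    also have "real b powr x ?m * real b powr - (x ?n + w * x ?m) = real b powr (x ?m - x ?n - w * x ?m)"
      by (simp add: powr_add[symmetric] algebra_simps)
    finally show ?thesis .
  qed
  have "approx_chain (real b) (\<lambda>n. real (a n)) w N (\<lambda>k. p (N k)) \<xi>"
    unfolding approx_chain_def using N(1) near half gap by (simp add: x_def)
  then show ?thesis using that N(2) by blast
qed

text \<open>Passing from \<open>a N\<close> to \<open>a (Suc N)\<close> costs a factor tending to
  \<open>\<eta>\<close>, hence the condition \<open>w * \<eta> < v\<close>. The supremum need not be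
  attained, but an admissible \<open>u\<close> with \<open>\<eta> < u / w\<close> is enough.\<close>

lemma uniform_set_eventually:
  fixes b :: nat and a :: "nat \<Rightarrow> nat" and \<eta> v w \<xi> :: real
  assumes b: "2 \<le> b" and \<eta>: "0 < \<eta>" and lim: "(\<lambda>n. real (a (n + 1)) / real (a n)) \<longlonglongrightarrow> \<eta>"
    and pos: "\<And>n. 1 \<le> n \<Longrightarrow> 0 < a n" and w: "0 < w" "w * \<eta> < v"
    and \<xi>: "\<xi> \<in> uniform_set b a v"
  shows "\<forall>\<^sub>F N in sequentially.
      Min ((\<lambda>n. dist_nearest_int (real b ^ a n * \<xi>)) ` {1..N}) < real b powr - (w * real (a (Suc N)))"
proof -
  obtain v' where v': "w * \<eta> < v'" "v' < v" using dense[OF w(2)] by auto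
  have "ereal v' < uniform_exponent b a \<xi>" using \<xi> v' less_le_trans[of "ereal v'" "ereal v"] by (simp add: uniform_set_def)
  then obtain u where u: "v' < u" and ev: "\<forall>\<^sub>F N in sequentially.
      Min ((\<lambda>n. dist_nearest_int (real b ^ a n * \<xi>)) ` {1..N}) < (real b ^ a N) powr - u"
    unfolding uniform_exponent_def less_SUP_iff by auto
  have "\<eta> < u / w" using v' u w by (simp add: field_simps)
  from order_tendstoD(2)[OF lim this] ev eventually_ge_at_top[of 1]
  show ?thesis
  proof eventually_elim
    case (elim N)
    have "w * real (a (Suc N)) \<le> u * real (a N)" using elim pos[of N] w by (simp add: field_simps)
    moreover have "(real b ^ a N) powr - u = real b powr - (u * real (a N))"
      using b by (simp add: powr_realpow[symmetric] powr_powr mult.commute)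
    ultimately have "(real b ^ a N) powr - u \<le> real b powr - (w * real (a (Suc N)))"
      using b by (auto intro!: powr_mono)
    then show ?case using elim by simp
  qed
qed

text \<open>By the ratio test \<open>n / a n\<close> is summable, so it tends to 0; thus
  \<open>a n\<close> outgrows every multiple of \<open>n\<close>, and the power of
  \<open>\<beta>\<close> beats \<open>C ^ n\<close>.\<close>

lemma summable_geometric_powr_growth:
  fixes a :: "nat \<Rightarrow> nat" and \<eta> \<beta> c C :: real
  assumes \<eta>: "1 < \<eta>" and lim: "(\<lambda>n. real (a (n + 1)) / real (a n)) \<longlonglongrightarrow> \<eta>"
    and pos: "\<And>n. 1 \<le> n \<Longrightarrow> 0 < a n" and \<beta>: "1 < \<beta>" and c: "0 < c" and C: "0 < C"
  shows "summable (\<lambda>n. C ^ n * \<beta> powr - (c * real (a n)))"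
proof -
  define y where "y n = real n / real (a n)" for n
  have "(\<lambda>n. (real n + 1) / real n / (real (a (n + 1)) / real (a n))) \<longlonglongrightarrow> 1 / \<eta>"
  proof (intro tendsto_divide lim)
    show "(\<lambda>n. (real n + 1) / real n) \<longlonglongrightarrow> 1"
      using LIMSEQ_Suc_n_over_n[where 'a = real] by (simp add: add.commute)
  qed (use \<eta> in auto)
  moreover obtain \<theta> where \<theta>: "1 / \<eta> < \<theta>" "\<theta> < 1" using dense[of "1 / \<eta>" 1] \<eta> by auto
  ultimately have "\<forall>\<^sub>F n in sequentially. (real n + 1) / real n / (real (a (n + 1)) / real (a n)) < \<theta>"
    by (intro order_tendstoD(2)) auto
  then obtain M where M: "\<And>n. M \<le> n \<Longrightarrow> (real n + 1) / real n / (real (a (n + 1)) / real (a n)) < \<theta>"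
    unfolding eventually_sequentially by blast
  have "summable y"
  proof (rule summable_ratio_test[OF \<theta>(2)])
    fix n assume n: "max 1 M \<le> n"
    then have "0 < a n" "0 < a (Suc n)" using pos by auto
    then have "y (Suc n) = (real n + 1) / real n / (real (a (n + 1)) / real (a n)) * y n"
      using n by (simp add: y_def)
    also have "\<dots> \<le> \<theta> * y n" using M[of n] n by (intro mult_right_mono) (auto simp: y_def)
    finally show "norm (y (Suc n)) \<le> \<theta> * norm (y n)" by (simp add: y_def)
  qed
  then have y0: "y \<longlonglongrightarrow> 0" by (rule summable_LIMSEQ_zero)
  \<comment> \<open>A positive upper bound for \<open>ln (2 * C)\<close>; the factor 2 leaves
    \<open>(1 / 2) ^ n\<close> as comparison series.\<close>
  define D where "D = \<bar>ln (2 * C)\<bar> + 1"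
  have D: "0 < D" by (simp add: D_def)
  have "0 < c * ln \<beta> / D" using c \<beta> D by simp
  from order_tendstoD(2)[OF y0 this]
  have "\<forall>\<^sub>F n in sequentially. norm (C ^ n * \<beta> powr - (c * real (a n))) \<le> (1 / 2) ^ n"
    using eventually_ge_at_top[of 1]
  proof eventually_elim
    case (elim n)
    then have "real n * D \<le> c * real (a n) * ln \<beta>"
      using pos[of n] D by (simp add: y_def field_simps)
    moreover have "real n * ln (2 * C) \<le> real n * D" by (intro mult_left_mono) (auto simp: D_def)
    ultimately have le: "real n * ln (2 * C) \<le> c * real (a n) * ln \<beta>" by linarith
    have "(2 * C) ^ n = exp (real n * ln (2 * C))" using C by (simp add: exp_of_nat_mult)
    also have "\<dots> \<le> exp (c * real (a n) * ln \<beta>)" using le by simp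
    also have "\<dots> = \<beta> powr (c * real (a n))" using \<beta> by (simp add: powr_def)
    finally have "2 ^ n * C ^ n \<le> \<beta> powr (c * real (a n))" by (simp add: power_mult_distrib)
    then have "C ^ n * \<beta> powr - (c * real (a n)) \<le> 1 / 2 ^ n"
      using \<beta> by (simp add: powr_minus field_simps)
    then show ?case using C by (simp add: power_one_over)
  qed
  then show ?thesis by (rule summable_comparison_test_ev) (simp add: summable_geometric)
qed

section \<open>The upper bound for the Hausdorff dimension\<close>

text \<open>Chains are available for \<open>w < v / \<eta>\<close>, whereas the hypotheses concern
  \<open>v / \<eta>\<close> itself. They are strict and continuous in \<open>w\<close>, so they
  persist for some \<open>w\<close> slightly below.\<close>

lemma hausdorff_measure_uniform_set_eq_0:
  fixes b :: nat and a :: "nat \<Rightarrow> nat" and \<eta> v s :: real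
  assumes b: "2 \<le> b" and mono: "\<And>i j. 1 \<le> i \<Longrightarrow> i < j \<Longrightarrow> a i < a j"
    and pos: "\<And>n. 1 \<le> n \<Longrightarrow> 0 < a n"
    and lim: "(\<lambda>n. real (a (n + 1)) / real (a n)) \<longlonglongrightarrow> \<eta>" and \<eta>: "1 < \<eta>"
    and v: "0 < v" "v < \<eta>" and l: "1 \<le> l"
    and win: "\<eta> ^ l < 2 / (1 - v / \<eta>)" "2 / (1 - v / \<eta>) < \<eta> ^ Suc l"
    and s: "0 < s" "ratio_bound (v / \<eta>) (\<eta> ^ l) < s" "ratio_bound (v / \<eta>) (\<eta> ^ Suc l) < s"
  shows "hausdorff_measure s (uniform_set b a v) = 0"
proof (intro hausdorff_measure_eq_0_if_content s)
  define w0 where "w0 = v / \<eta>"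
  have w0: "0 < w0" "w0 < 1" using v \<eta> by (auto simp: w0_def)
  have rb: "((\<lambda>w. ratio_bound w q) \<longlongrightarrow> ratio_bound w0 q) (at_left w0)" if "1 < q" for q
  proof -
    have "1 + w0 * q \<noteq> 0" using that w0 by (smt (verit) mult_pos_pos)
    then show ?thesis unfolding ratio_bound_def using that by (intro tendsto_intros) auto
  qed
  have thr: "((\<lambda>w. 2 / (1 - w)) \<longlongrightarrow> 2 / (1 - w0)) (at_left w0)"
    using w0 by (intro tendsto_intros) auto
  have q: "1 < \<eta> ^ l" "1 < \<eta> ^ Suc l" using \<eta> l one_less_power[of \<eta> l] one_less_power[of \<eta> "Suc l"] by auto
  have "\<forall>\<^sub>F w in at_left w0. w < w0" by (simp add: eventually_at_filter)
  moreover have "\<forall>\<^sub>F w in at_left w0. 0 < w"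
    using order_tendstoD(1)[OF tendsto_ident_at w0(1)] .
  ultimately have "\<forall>\<^sub>F w in at_left w0. w < w0 \<and> 0 < w \<and> \<eta> ^ l < 2 / (1 - w) \<and> 2 / (1 - w) < \<eta> ^ Suc l
      \<and> ratio_bound w (\<eta> ^ l) < s \<and> ratio_bound w (\<eta> ^ Suc l) < s"
    using order_tendstoD(1)[OF thr win(1)[folded w0_def]] order_tendstoD(2)[OF thr win(2)[folded w0_def]]
      order_tendstoD(2)[OF rb[OF q(1)] s(2)[folded w0_def]]
      order_tendstoD(2)[OF rb[OF q(2)] s(3)[folded w0_def]]
    by eventually_elim simp
  then obtain w where w: "w < w0" "0 < w" "\<eta> ^ l < 2 / (1 - w)" "2 / (1 - w) < \<eta> ^ Suc l"
    "ratio_bound w (\<eta> ^ l) < s" "ratio_bound w (\<eta> ^ Suc l) < s"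
    using eventually_happens[of _ "at_left w0"] by (auto simp: trivial_limit_at_left_real)
  have w1: "w < 1" using w w0 by simp
  have wv: "w * \<eta> < v" using w \<eta> by (simp add: w0_def field_simps)
  \<comment> \<open>Here \<open>T < s\<close> makes the covers summable, \<open>T' < T\<close>
    provides the growth in \<open>infinitely_many_good_indices\<close>, and \<open>T'\<close> lies
    above the two limits because the ratios only approach powers of \<open>\<eta>\<close>.\<close>
  obtain T where T: "max 0 (max (ratio_bound w (\<eta> ^ l)) (ratio_bound w (\<eta> ^ Suc l))) < T" "T < s"
    using dense[of "max 0 (max (ratio_bound w (\<eta> ^ l)) (ratio_bound w (\<eta> ^ Suc l)))" s] w s by auto
  obtain T' where T': "max (ratio_bound w (\<eta> ^ l)) (ratio_bound w (\<eta> ^ Suc l)) < T'" "T' < T"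
    using dense[of "max (ratio_bound w (\<eta> ^ l)) (ratio_bound w (\<eta> ^ Suc l))" T] T by auto
  obtain \<rho> where \<rho>: "1 < \<rho>" "\<rho> < \<eta>" using dense[OF \<eta>] by auto
  define x where "x n = real (a n)" for n
  have ev: "\<forall>\<^sub>F n in sequentially. \<forall>m>n. \<rho> \<le> x m / x n \<and> ratio_bound w (x m / x n) \<le> T'"
  proof -
    have "\<forall>\<^sub>F n in sequentially. \<forall>m>n. ratio_bound w (real (a m) / real (a n)) \<le> T'"
      using T' by (intro eventually_ratio_bound_le[OF \<eta> lim mono pos w(2) w1 l w(3,4)]) auto
    with order_tendstoD(1)[OF lim \<rho>(2)] eventually_ge_at_top[of 1] show ?thesis
    proof eventually_elim
      case (elim n)
      have "x (n + 1) / x n \<le> x m / x n" if "n < m" for m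
        using that mono[of "n + 1" m] by (cases "m = n + 1") (auto intro!: divide_right_mono simp: x_def less_imp_le)
      then show ?case using elim by (fastforce simp: x_def)
    qed
  qed
  have good: "\<exists>\<^sub>\<infinity>k. x (N k) - w * (\<Sum>i\<le>k. x (N i)) < T * (x (N k) + w * x (N (Suc k)))"
    if N: "strict_mono N" "\<And>k. 1 \<le> N k" for N
  proof (rule infinitely_many_good_indices[OF w(2) _ T'(2) \<rho>(1)])
    show "0 < T" using T by simp
    show "0 < x (N k)" for k using pos[OF N(2)] by (simp add: x_def)
    from eventually_compose_filterlim[OF ev filterlim_subseq[OF N(1)]]
    show "\<forall>\<^sub>F k in sequentially. \<rho> \<le> x (N (Suc k)) / x (N k) \<and> ratio_bound w (x (N (Suc k)) / x (N k)) \<le> T'"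
      by eventually_elim (use N(1) in \<open>simp add: strict_mono_Suc_iff\<close>)
  qed
  \<comment> \<open>The countable set \<open>Z\<close> contains the points where some distance is 0
    and the records stop. The others are split by their first numerator, again into countably many
    sets.\<close>
  define Z where "Z = (\<Union>n. range (\<lambda>q :: int. real_of_int q / real b ^ a n))"
  define G where "G p = {\<xi>. \<exists>N q. approx_chain (real b) x w N q \<xi> \<and> q 0 = p \<and>
      (\<exists>\<^sub>\<infinity>k. x (N k) - w * (\<Sum>i\<le>k. x (N i)) < T * (x (N k) + w * x (N (Suc k))))}" for p
  have "uniform_set b a v \<subseteq> Z \<union> (\<Union>p. G p)"
  proof
    fix \<xi> assume \<xi>: "\<xi> \<in> uniform_set b a v"
    show "\<xi> \<in> Z \<union> (\<Union>p. G p)"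
    proof (cases "\<exists>n\<ge>1. dist_nearest_int (real b ^ a n * \<xi>) = 0")
      case True
      then obtain n where "dist_nearest_int (real b ^ a n * \<xi>) = 0" by blast
      then obtain q :: int where "real b ^ a n * \<xi> = real_of_int q"
        using dist_nearest_int_attained[of "real b ^ a n * \<xi>"] by auto
      then have "\<xi> = real_of_int q / real b ^ a n" using b by (simp add: field_simps)
      then show ?thesis by (auto simp: Z_def)
    next
      case False
      have "0 \<le> dist_nearest_int y" for y by (simp add: dist_nearest_int_def infdist_nonneg)
      with False have "0 < dist_nearest_int (real b ^ a n * \<xi>)" if "1 \<le> n" for n
        using that by (simp add: order_less_le)
      from approx_chain_exists[OF b w(2) mono this uniform_set_eventually[OF b _ lim pos w(2) wv \<xi>]] \<eta>
      obtain N q where "approx_chain (real b) (\<lambda>n. real (a n)) w N q \<xi>" "\<And>k. 1 \<le> N k" by auto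
      then have "approx_chain (real b) x w N q \<xi>" "\<And>k. 1 \<le> N k" by (simp_all add: x_def[abs_def])
      moreover from this have "strict_mono N" by (simp add: approx_chain_def)
      ultimately have "\<xi> \<in> G (q 0)" unfolding G_def using good by blast
      then show ?thesis by blast
    qed
  qed
  moreover have "hausdorff_content s Z = 0"
    unfolding Z_def by (intro hausdorff_content_countable s) auto
  moreover have "hausdorff_content s (\<Union>p. G p) = 0"
  proof (intro hausdorff_content_eq_0_UN)
    fix p :: int
    have sm: "summable (\<lambda>n. 12 ^ n * real b powr (- ((s - T) * w * x n)))"
      unfolding x_def using b w T by (intro summable_geometric_powr_growth[OF \<eta> lim pos]) auto
    show "hausdorff_content s (G p) = 0"
      using b T w w1 by (intro hausdorff_content_chains_eq_0[where p = p, OF _ _ _ _ _ _ sm]) (auto simp: G_def x_def[abs_def])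
  qed simp
  ultimately show "hausdorff_content s (uniform_set b a v) = 0"
    using hausdorff_content_mono[of "uniform_set b a v" "Z \<union> (\<Union>p. G p)" s]
      hausdorff_content_Un[of s Z "\<Union>p. G p"] by simp
qed

theorem theorem1p2:
  fixes b :: nat and a :: "nat \<Rightarrow> nat" and \<eta> v :: real
  assumes "2 \<le> b"
    and "strict_mono_on {1..} a"
    and "\<And>n. 1 \<le> n \<Longrightarrow> 0 < a n"
    and "(\<lambda>n. real (a (n + 1)) / real (a n)) \<longlonglongrightarrow> \<eta>"
    and "1 < \<eta>"
    and "v \<in> (\<Union>l\<in>{l0 \<eta>..}. {\<eta> - 2 * \<eta> / (\<eta> powi l + 1) <..< \<eta> - 2 / \<eta> powi l})"
  shows "hausdorff_dim (uniform_set b a v) \<le> ereal (dim_bound \<eta> v)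
       \<and> dim_bound \<eta> v < ((\<eta> - v) / (\<eta> + v))\<^sup>2"
proof -
  from exponent_window[OF assms(5,6)] obtain l where l: "1 \<le> l" "l1 \<eta> v = int l"
    and v: "0 < v" "v < \<eta>" "1 + v / \<eta> < \<eta> ^ l"
    and win: "(1 - v / \<eta>) * (\<eta> ^ l + 1) < 2" "2 < (1 - v / \<eta>) * \<eta> ^ Suc l" by blast
  note bound = dim_bound_properties[OF assms(5) l v win]
  have mono: "a i < a j" if "1 \<le> i" "i < j" for i j
    using assms(2) that by (auto simp: strict_mono_on_def)
  have u: "0 < 1 - v / \<eta>" using v assms(5) by simp
  have win': "\<eta> ^ l < 2 / (1 - v / \<eta>)" "2 / (1 - v / \<eta>) < \<eta> ^ Suc l"
    using win u by (simp_all add: pos_less_divide_eq pos_divide_less_eq algebra_simps)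
  have "hausdorff_dim (uniform_set b a v) \<le> ereal (dim_bound \<eta> v)"
  proof (rule ccontr)
    assume "\<not> ?thesis"
    then obtain s where s: "ereal (dim_bound \<eta> v) < ereal s" "ereal s < hausdorff_dim (uniform_set b a v)"
      using ereal_dense2 by (metis not_le)
    \<comment> \<open>This \<open>s\<close> is positive because \<open>dim_bound \<eta> v\<close>
      is.\<close>
    have "hausdorff_measure s (uniform_set b a v) = 0"
      using s bound
      by (intro hausdorff_measure_uniform_set_eq_0[OF assms(1) mono assms(3-5) v(1,2) l(1) win']) auto
    then have "hausdorff_dim (uniform_set b a v) \<le> ereal s"
      unfolding hausdorff_dim_def using s bound by (intro INF_lower) auto
    with s show False by simp
  qed
  with bound show ?thesis by simp
qed

end
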